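(* Consider the interval-monitored step-stress accelerated life-test model with Weibull lifetimes described in the context, with tuning parameter $\beta\ge 0$ and restriction $\boldsymbol{m}(\boldsymbol{\theta})=\boldsymbol{0}_r$. Assume that all matrices defined below exist finitely (and the indicated inverses exist), and suppose that the true distribution belongs to the model with true parameter $\boldsymbol{\theta}_0\in\Theta$ satisfying $\boldsymbol{m}(\boldsymbol{\theta}_0)=\boldsymbol{0}_r$. Then: (1) the RMDPDE estimating equations $$\boldsymbol{W}^T(\boldsymbol{\theta})\boldsymbol{D}_{\boldsymbol{\pi}(\boldsymbol{\theta})}^{\beta-1}\big(\widehat{\boldsymbol{p}}-\boldsymbol{\pi}(\boldsymbol{\theta})\big)+\boldsymbol{M}(\boldsymbol{\theta})\boldsymbol{\lambda}_\beta=\boldsymbol{0}_3,\qquad \boldsymbol{m}(\boldsymbol{\theta})=\boldsymbol{0}_r,$$ (with $\boldsymbol{\lambda}_\beta\in\mathbb{R}^r$ a vector of Lagrange multipliers) have a consistent sequence of roots $\widetilde{\boldsymbol{\theta}}_\beta$, i.e. $\widetilde{\boldsymbol{\theta}}_\beta\xrightarrow{P}\boldsymbol{\theta}_0$ as $N\to\infty$; (2) $$\sqrt{N}\big(\widetilde{\boldsymbol{\theta}}_\beta-\boldsymbol{\theta}_0\big)\xrightarrow[N\to\infty]{L}\mathcal{N}\big(\boldsymbol{0},\boldsymbol{\Sigma}_\beta(\boldsymbol{\theta}_0)\big),$$ where $\boldsymbol{\Sigma}_\beta(\boldsymbol{\theta}_0)=\boldsymbol{P}_\beta(\boldsymbol{\theta}_0)\boldsymbol{K}_\beta(\boldsymbol{\theta}_0)\boldsymbol{P}_\beta(\boldsymbol{\theta}_0)^T$,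 $\boldsymbol{P}_\beta(\boldsymbol{\theta}_0)=\boldsymbol{J}_\beta(\boldsymbol{\theta}_0)^{-1}-\boldsymbol{Q}_\beta(\boldsymbol{\theta}_0)\boldsymbol{M}^T(\boldsymbol{\theta}_0)\boldsymbol{J}_\beta(\boldsymbol{\theta}_0)^{-1}$, $\boldsymbol{Q}_\beta(\boldsymbol{\theta}_0)=\boldsymbol{J}_\beta(\boldsymbol{\theta}_0)^{-1}\boldsymbol{M}(\boldsymbol{\theta}_0)\big[\boldsymbol{M}^T(\boldsymbol{\theta}_0)\boldsymbol{J}_\beta(\boldsymbol{\theta}_0)^{-1}\boldsymbol{M}(\boldsymbol{\theta}_0)\big]^{-1}$, $\boldsymbol{J}_\beta(\boldsymbol{\theta}_0)=\boldsymbol{W}^T\boldsymbol{D}_{\boldsymbol{\pi}(\boldsymbol{\theta}_0)}^{\beta-1}\boldsymbol{W}$ and $\boldsymbol{K}_\beta(\boldsymbol{\theta}_0)=\boldsymbol{W}^T\big(\boldsymbol{D}_{\boldsymbol{\pi}(\boldsymbol{\theta}_0)}^{2\beta-1}-\boldsymbol{\pi}(\boldsymbol{\theta}_0)^{\beta}\boldsymbol{\pi}(\boldsymbol{\theta}_0)^{\beta T}\big)\boldsymbol{W}$, with $\boldsymbol{W}=\boldsymbol{W}(\boldsymbol{\theta}_0)$.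
   Context: Step-stress model: stress levels $x_1<\dots<x_k$ are applied, the stress being raised from $x_i$ to $x_{i+1}$ at fixed times $\tau_1<\dots<\tau_{k-1}$; the test ends at $\tau_k$ (set $\tau_0=0$). Parameter $\boldsymbol{\theta}=(a_0,a_1,\eta)^T\in\Theta=\mathbb{R}\times\mathbb{R}^{-}\times\mathbb{R}^{+}$; the Weibull scale at stress $x_i$ is $\lambda_i=\exp(a_0+a_1x_i)$ and the shape $\eta$ is common. Under the cumulative exposure model the lifetime $T$ has cdf $F_T(t)=1-\exp\!\big(-((t+h_{i-1})/\lambda_i)^\eta\big)$ for $t\in[\tau_{i-1},\tau_i)$ (and $t\in[\tau_{k-1},\tau_k]$ for $i=k$), where $h_0=0$ and the shifting times $h_{i-1}$ are chosen so that $F_T$ is continuous at each $\tau_{i-1}$. Inspection times $0=t_0<t_1<\dots<t_L=\tau_k$ include all $\tau_i$. For $j=1,\dots,L$, $\pi_j(\boldsymbol{\theta})=F_T(t_j)-F_T(t_{j-1})$ and $\pi_{L+1}(\boldsymbol{\theta})=1-F_T(t_L)$; $\boldsymbol{\pi}(\boldsymbol{\theta})=(\pi_1,\dots,\pi_{L+1})^T$. $N$ units are tested; $n_j$ is the number of failures in $(t_{j-1},t_j]$ ($j\le L$), $n_{L+1}$ the number of survivors, so $(n_1,\dots,n_{L+1})$ is multinomial$(N,\boldsymbol{\pi}(\boldsymbol{\theta}))$; $\widehat{p}_j=n_j/N$, $\widehat{\boldsymbol{p}}=(\widehat p_1,\dots,\widehat p_{L+1})^T$. The density power divergence for $\beta>0$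 is $d_\beta(\widehat{\boldsymbol{p}},\boldsymbol{\pi}(\boldsymbol{\theta}))=\sum_{j=1}^{L+1}\big(\pi_j(\boldsymbol{\theta})^{1+\beta}-(1+\tfrac1\beta)\widehat p_j\pi_j(\boldsymbol{\theta})^\beta+\tfrac1\beta\widehat p_j^{1+\beta}\big)$, and for $\beta=0$ it is the Kullback–Leibler divergence $\sum_j\widehat p_j\log(\widehat p_j/\pi_j(\boldsymbol{\theta}))$. The restriction function $\boldsymbol{m}:\Theta\to\mathbb{R}^r$ ($r\le 3$) is differentiable with $\boldsymbol{M}(\boldsymbol{\theta})=\partial\boldsymbol{m}^T(\boldsymbol{\theta})/\partial\boldsymbol{\theta}$ a continuous $3\times r$ matrix of rank $r$; $\Theta_0=\{\boldsymbol{\theta}:\boldsymbol{m}(\boldsymbol{\theta})=\boldsymbol{0}_r\}$. The restricted minimum DPD estimator (RMDPDE) is $\widetilde{\boldsymbol{\theta}}_\beta=\arg\min_{\boldsymbol{\theta}\in\Theta_0}d_\beta(\widehat{\boldsymbol{p}},\boldsymbol{\pi}(\boldsymbol{\theta}))$. $\boldsymbol{W}(\boldsymbol{\theta})$ is the $(L+1)\times 3$ matrix whose $j$-th row is $\boldsymbol{w}_j^T=\partial\pi_j(\boldsymbol{\theta})/\partial\boldsymbol{\theta}^T$. $\boldsymbol{D}_{\boldsymbol{\pi}(\boldsymbol{\theta})}$ is the diagonal matrix with entries $\pi_j(\boldsymbol{\theta})$, and $\boldsymbol{\pi}(\boldsymbol{\theta})^\beta$ is the vector with entries $\pi_j(\boldsymbol{\theta})^\beta$.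 *)

theory Defs
  imports "HOL-Probability.Probability"
begin

text \<open>Parameter theta = (a0, a1, eta) is a vector in real^3: component 1 is a0,
  component 2 is a1, component 3 is the shape eta.\<close>

definition Theta :: "(real^3) set" where
  "Theta = {\<theta>. \<theta>$2 < 0 \<and> \<theta>$3 > 0}"

definition wscale :: "(nat \<Rightarrow> real) \<Rightarrow> real^3 \<Rightarrow> nat \<Rightarrow> real" where
  "wscale x \<theta> i = exp (\<theta>$1 + \<theta>$2 * x i)"

text \<open>Shifting times h_i: h_0 = 0 and h_i is the unique value making the cdf
  continuous at tau_i, i.e. (tau_i + h_(i-1))/lambda_i = (tau_i + h_i)/lambda_(i+1).\<close>
fun shift :: "(nat \<Rightarrow> real) \<Rightarrow> (nat \<Rightarrow> real) \<Rightarrow> real^3 \<Rightarrow> nat \<Rightarrow> real" where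
  "shift x \<tau> \<theta> 0 = 0"
| "shift x \<tau> \<theta> (Suc i) =
     wscale x \<theta> (i + 2) / wscale x \<theta> (i + 1) * (\<tau> (i + 1) + shift x \<tau> \<theta> i) - \<tau> (i + 1)"

text \<open>Index i of the step containing time s: s in [tau_(i-1), tau_i), and i = k for s = tau_k.\<close>
definition seg :: "(nat \<Rightarrow> real) \<Rightarrow> nat \<Rightarrow> real \<Rightarrow> nat" where
  "seg \<tau> k s = (if \<tau> k \<le> s then k else (LEAST i. s < \<tau> i))"

definition cdfT :: "(nat \<Rightarrow> real) \<Rightarrow> (nat \<Rightarrow> real) \<Rightarrow> nat \<Rightarrow> real^3 \<Rightarrow> real \<Rightarrow> real" where
  "cdfT x \<tau> k \<theta> s =
     (let i = seg \<tau> k s in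
      1 - exp (- (((s + shift x \<tau> \<theta> (i - 1)) / wscale x \<theta> i) powr (\<theta>$3))))"

definition piv :: "(nat \<Rightarrow> real) \<Rightarrow> (nat \<Rightarrow> real) \<Rightarrow> nat \<Rightarrow> (nat \<Rightarrow> real) \<Rightarrow> nat
                   \<Rightarrow> real^3 \<Rightarrow> nat \<Rightarrow> real" where
  "piv x \<tau> k t L \<theta> j =
     (if j \<le> L then cdfT x \<tau> k \<theta> (t j) - cdfT x \<tau> k \<theta> (t (j - 1))
      else 1 - cdfT x \<tau> k \<theta> (t L))"

definition wrow :: "(nat \<Rightarrow> real) \<Rightarrow> (nat \<Rightarrow> real) \<Rightarrow> nat \<Rightarrow> (nat \<Rightarrow> real) \<Rightarrow> nat
                   \<Rightarrow> real^3 \<Rightarrow> nat \<Rightarrow> real^3" where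
  "wrow x \<tau> k t L \<theta> j =
     (\<chi> a. deriv (\<lambda>s. piv x \<tau> k t L (\<theta> + s *\<^sub>R axis a 1) j) 0)"

definition Jmat :: "real \<Rightarrow> nat \<Rightarrow> (nat \<Rightarrow> real) \<Rightarrow> (nat \<Rightarrow> real^3) \<Rightarrow> real^3^3" where
  "Jmat \<beta> L p w = (\<chi> a b. \<Sum>j=1..L+1. w j $ a * p j powr (\<beta> - 1) * w j $ b)"

definition Kmat :: "real \<Rightarrow> nat \<Rightarrow> (nat \<Rightarrow> real) \<Rightarrow> (nat \<Rightarrow> real^3) \<Rightarrow> real^3^3" where
  "Kmat \<beta> L p w = (\<chi> a b.
      (\<Sum>j=1..L+1. w j $ a * p j powr (2 * \<beta> - 1) * w j $ b)
      - (\<Sum>j=1..L+1. w j $ a * p j powr \<beta>) * (\<Sum>j=1..L+1. p j powr \<beta> * w j $ b))"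

definition rmdpde_eqs ::
  "real \<Rightarrow> nat \<Rightarrow> (real^3 \<Rightarrow> nat \<Rightarrow> real) \<Rightarrow> (real^3 \<Rightarrow> nat \<Rightarrow> real^3)
   \<Rightarrow> (real^3 \<Rightarrow> real^'r) \<Rightarrow> (real^3 \<Rightarrow> real^'r^3) \<Rightarrow> (nat \<Rightarrow> real) \<Rightarrow> real^3 \<Rightarrow> real^'r \<Rightarrow> bool"
  where
  "rmdpde_eqs \<beta> L p w m M phat \<theta> lam \<longleftrightarrow>
     (\<forall>a. (\<Sum>j=1..L+1. w \<theta> j $ a * p \<theta> j powr (\<beta> - 1) * (phat j - p \<theta> j))
            + (M \<theta> *v lam) $ a = 0)
     \<and> m \<theta> = 0"

definition cat_pmf :: "nat \<Rightarrow> (nat \<Rightarrow> real) \<Rightarrow> nat pmf" where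
  "cat_pmf L p = pmf_of_list (map (\<lambda>j. (j, p j)) [1..<L+2])"

fun multinomial_pmf :: "nat \<Rightarrow> nat pmf \<Rightarrow> (nat \<Rightarrow> nat) pmf" where
  "multinomial_pmf 0 c = return_pmf (\<lambda>_. 0)"
| "multinomial_pmf (Suc n) c =
     bind_pmf (multinomial_pmf n c) (\<lambda>v. map_pmf (\<lambda>j. v(j := Suc (v j))) c)"

definition normal0 :: "real \<Rightarrow> real measure" where
  "normal0 v = (if v = 0 then return borel 0 else density lborel (normal_density 0 (sqrt v)))"

definition is_normal_vec :: "(real^'n) measure \<Rightarrow> real^'n^'n \<Rightarrow> bool" where
  "is_normal_vec \<mu> S \<longleftrightarrow> prob_space \<mu> \<and> sets \<mu> = sets borel \<and>
     (\<forall>t. distr \<mu> borel (\<lambda>z. t \<bullet> z) = normal0 (t \<bullet> (S *v t)))"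

definition conv_law :: "(nat \<Rightarrow> (real^'n) measure) \<Rightarrow> (real^'n) measure \<Rightarrow> bool" where
  "conv_law \<mu>s \<mu> \<longleftrightarrow>
     (\<forall>f :: real^'n \<Rightarrow> real. continuous_on UNIV f \<and> bounded (range f) \<longrightarrow>
        (\<lambda>N. integral\<^sup>L (\<mu>s N) f) \<longlonglongrightarrow> integral\<^sup>L \<mu> f)"

end

theory Submission
  imports Defs
begin

text \<open>
  Put \<open>a\<^sub>j(\<theta>) = \<pi>\<^sub>j(\<theta>)\<^bsup>\<beta>-1\<^esup> w\<^sub>j(\<theta>)\<close>. The estimating equations are
  \<open>H(\<theta>, \<lambda>; q) = (\<Sum>\<^sub>j (q\<^sub>j - \<pi>\<^sub>j(\<theta>)) a\<^sub>j(\<theta>) + M(\<theta>) \<lambda>, m(\<theta>)) = 0\<close> with \<open>q\<close> the vector of observed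
  frequencies. At \<open>(\<theta>\<^sub>0, 0; \<pi>(\<theta>\<^sub>0))\<close> the map \<open>H\<close> vanishes and is differentiable in \<open>(\<theta>, \<lambda>)\<close> with an
  invertible derivative, because \<open>J\<close> and \<open>M\<^sup>T J\<^sup>-\<^sup>1 M\<close> are invertible. Brouwer's theorem for the Newton map
  then gives, for every \<open>q\<close> close to \<open>\<pi>(\<theta>\<^sub>0)\<close>, a root \<open>E(q)\<close> with
  \<open>E(q) = \<theta>\<^sub>0 + P \<Sum>\<^sub>j (q\<^sub>j - \<pi>\<^sub>j(\<theta>\<^sub>0)) a\<^sub>j(\<theta>\<^sub>0) + o(\<bar>q - \<pi>(\<theta>\<^sub>0)\<bar>)\<close>; neither a minimisation nor second
  derivatives are involved. Chebyshev's inequality for the multinomial frequencies yields consistency. The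
  characteristic functions of the normalised frequencies converge to Gaussian ones, which carries over to
  \<open>\<surd>N (E(q) - \<theta>\<^sub>0)\<close> by the expansion, and tightness together with the uniform approximation of continuous
  functions by trigonometric polynomials turns this into convergence in law.
\<close>

section \<open>Weak convergence and trigonometric polynomials\<close>

text \<open>Split the integral of the difference over \<open>A\<close> and its complement. It is
  used three times with \<open>A\<close> an unlikely event: the exterior of a large ball, under the
  limit law and under the approximating laws, and the event that the linearisation of the estimator
  is poor.\<close>

lemma (in prob_space) expectation_diff_le:
  fixes f g :: "'a \<Rightarrow> real"
  assumes int: "integrable M f" "integrable M g" and A: "A \<in> sets M"
    and near: "\<And>x. x \<in> space M \<Longrightarrow> x \<notin> A \<Longrightarrow> \<bar>f x - g x\<bar> \<le> e"
    and bound: "\<And>x. x \<in> space M \<Longrightarrow> \<bar>f x - g x\<bar> \<le> C" and e: "0 \<le> e"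
  shows "\<bar>expectation f - expectation g\<bar> \<le> e + C * prob A"
proof -
  have "\<bar>expectation f - expectation g\<bar> = \<bar>expectation (\<lambda>x. f x - g x)\<bar>"
    using int by simp
  also have "\<dots> \<le> expectation (\<lambda>x. \<bar>f x - g x\<bar>)"
    by (rule integral_abs_bound)
  also have "\<dots> \<le> expectation (\<lambda>x. e + C * indicator A x)"
  proof (rule integral_mono)
    show "integrable M (\<lambda>x. \<bar>f x - g x\<bar>)" using int by simp
    show "integrable M (\<lambda>x. e + C * indicator A x)" using A by (simp add: emeasure_eq_measure)
    fix x assume x: "x \<in> space M"
    show "\<bar>f x - g x\<bar> \<le> e + C * indicator A x"
      using near[OF x] bound[OF x] e by (cases "x \<in> A") auto
  qed
  also have "\<dots> = e + C * prob A"
    using A by (simp add: emeasure_eq_measure prob_space)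
  finally show ?thesis .
qed

text \<open>The real span of all phase-shifted waves. The free phase \<open>b\<close> supplies the
  sines as well, so the product-to-sum formula for cosines stays inside the class and it is an
  algebra. As an inductive set it lets a limit known for single waves extend to the whole algebra by
  rule induction.\<close>

inductive_set trig_poly :: "('a::euclidean_space \<Rightarrow> real) set" where
  wave: "(\<lambda>x. cos (t \<bullet> x + b)) \<in> trig_poly"
| scale: "f \<in> trig_poly \<Longrightarrow> (\<lambda>x. c * f x) \<in> trig_poly"
| add: "f \<in> trig_poly \<Longrightarrow> g \<in> trig_poly \<Longrightarrow> (\<lambda>x. f x + g x) \<in> trig_poly"

lemma trig_poly_const: "(\<lambda>x. c) \<in> trig_poly"
  using trig_poly.scale[OF trig_poly.wave[of 0 0], of c] by simp

lemma trig_poly_mult_wave: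
  assumes "g \<in> trig_poly"
  shows "(\<lambda>x. cos (t \<bullet> x + b) * g x) \<in> trig_poly"
  using assms
proof induction
  case (wave s c)
  have "cos (t \<bullet> x + b) * cos (s \<bullet> x + c)
      = 1/2 * (cos ((t - s) \<bullet> x + (b - c)) + cos ((t + s) \<bullet> x + (b + c)))" for x
    by (simp add: cos_times_cos inner_diff_left inner_add_left algebra_simps)
  then show ?case by (simp only:) (intro trig_poly.intros)
next
  case (scale f c)
  show ?case using trig_poly.scale[OF scale.IH, of c] by (simp add: mult.left_commute)
next
  case (add f g)
  show ?case using trig_poly.add[OF add.IH] by (simp add: distrib_left)
qed

lemma trig_poly_mult:
  assumes "f \<in> trig_poly" "g \<in> trig_poly"
  shows "(\<lambda>x. f x * g x) \<in> trig_poly"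
  using assms(1)
proof induction
  case (wave t b)
  show ?case by (rule trig_poly_mult_wave[OF assms(2)])
next
  case (scale f c)
  show ?case using trig_poly.scale[OF scale.IH, of c] by (simp add: mult.assoc)
next
  case (add f h)
  show ?case using trig_poly.add[OF add.IH] by (simp add: distrib_right)
qed

lemma continuous_on_trig_poly:
  assumes "f \<in> trig_poly" shows "continuous_on S f"
  using assms by induction (auto intro!: continuous_intros)

lemma bounded_trig_poly:
  assumes "f \<in> trig_poly" obtains B where "B > 0" "\<And>x. \<bar>f x\<bar> \<le> B"
proof -
  from assms have "\<exists>B. \<forall>x. \<bar>f x\<bar> \<le> B"
  proof induction
    case (wave t b)
    show ?case by (rule exI[of _ 1]) auto
  next
    case (scale f c)
    then obtain B where "\<forall>x. \<bar>f x\<bar> \<le> B" by blast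
    then show ?case by (intro exI[of _ "\<bar>c\<bar> * B"]) (auto simp: abs_mult intro: mult_left_mono)
  next
    case (add f g)
    then obtain B C where "\<forall>x. \<bar>f x\<bar> \<le> B" "\<forall>x. \<bar>g x\<bar> \<le> C" by blast
    then show ?case by (intro exI[of _ "B + C"]) (meson abs_triangle_ineq add_mono order_trans)
  qed
  then obtain B where "\<forall>x. \<bar>f x\<bar> \<le> B" by blast
  then show ?thesis by (intro that[of "max B 1"]) (auto simp: max_def, meson dual_order.trans linear)
qed

lemma trig_poly_compose_polynomial:
  assumes "real_polynomial_function q" "f \<in> trig_poly"
  shows "(\<lambda>x. q (f x)) \<in> trig_poly"
  using assms(1)
proof induction
  case (linear q)
  have "(\<lambda>x. q (f x)) = (\<lambda>x. q 1 * f x)"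
  proof
    show "q (f x) = q 1 * f x" for x
      using linear_cmul[OF bounded_linear.linear[OF linear], of "f x" 1] by simp
  qed
  then show ?case using trig_poly.scale[OF assms(2), of "q 1"] by simp
qed (auto intro: trig_poly_const trig_poly.add trig_poly_mult)

text \<open>The frequency is taken along \<open>x - y\<close> and scaled so that the phases at the
  two points differ by exactly 1; shifting the phase to 0 at \<open>y\<close> leaves the values
  \<open>cos 1\<close> and \<open>cos 0\<close>.\<close>

lemma trig_poly_separates:
  assumes "x \<noteq> y"
  shows "\<exists>f\<in>trig_poly. f x \<noteq> f y"
proof -
  define t where "t = (1 / (norm (x - y))\<^sup>2) *\<^sub>R (x - y)"
  have "t \<bullet> (x - y) = 1"
    using assms by (simp add: t_def dot_square_norm)
  then have "t \<bullet> x + - (t \<bullet> y) = 1" by (simp add: inner_diff_right)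
  then have "cos (t \<bullet> x + - (t \<bullet> y)) = cos 1" by simp
  moreover have "cos (t \<bullet> y + - (t \<bullet> y)) = 1" by simp
  moreover have "cos 1 \<noteq> (1::real)"
    using cos_monotone_0_pi[of 0 1] pi_gt3 by simp
  ultimately show ?thesis
    using trig_poly.wave[of t "- (t \<bullet> y)"] by (intro bexI) auto
qed

text \<open>Stone--Weierstrass only controls the trigonometric polynomial on the compact set; composing
  with a polynomial close to the truncation at height \<open>B\<close> bounds it on the whole space.\<close>

lemma trig_poly_approx:
  fixes f :: "'a::euclidean_space \<Rightarrow> real"
  assumes K: "compact K" and f: "continuous_on K f" and B: "\<And>x. x \<in> K \<Longrightarrow> \<bar>f x\<bar> \<le> B" "0 \<le> B" and e: "0 < e"
  obtains g where "g \<in> trig_poly" "\<And>x. x \<in> K \<Longrightarrow> \<bar>f x - g x\<bar> \<le> e" "\<And>x. \<bar>g x\<bar> \<le> B + e"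
proof -
  interpret function_ring_on trig_poly K
    by unfold_locales
      (auto intro: K continuous_on_trig_poly trig_poly.add trig_poly_mult trig_poly_const trig_poly_separates)
  obtain h where h: "h \<in> trig_poly" "\<And>x. x \<in> K \<Longrightarrow> \<bar>f x - h x\<bar> < e / 2"
    using Stone_Weierstrass_basic[OF f, of "e / 2"] e by auto
  obtain C where C: "\<And>x. \<bar>h x\<bar> \<le> C"
    using bounded_trig_poly[OF h(1)] by blast
  define c where "c y = max (- B) (min B y)" for y :: real
  have "continuous_on {- C..C} c"
    unfolding c_def by (intro continuous_intros)
  then obtain q where q: "real_polynomial_function q" "\<And>y. y \<in> {- C..C} \<Longrightarrow> \<bar>c y - q y\<bar> < e / 2"
    using Stone_Weierstrass_real_polynomial_function[of "{- C..C}" c "e / 2"] e by auto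
  have qh: "\<bar>c (h x) - q (h x)\<bar> < e / 2" for x
    using q(2)[of "h x"] C[of x] by (simp add: abs_le_iff)
  show ?thesis
  proof (rule that[of "\<lambda>x. q (h x)"])
    show "(\<lambda>x. q (h x)) \<in> trig_poly" by (rule trig_poly_compose_polynomial[OF q(1) h(1)])
    show "\<bar>q (h x)\<bar> \<le> B + e" for x
      using qh[of x] B(2) e unfolding c_def by linarith
    \<comment> \<open>On \<open>K\<close> the value \<open>f x\<close> lies in
      \<open>[-B, B]\<close>, so clipping \<open>h x\<close> to that interval cannot move it away
      from \<open>f x\<close>; the two errors of \<open>e / 2\<close> then add up.\<close>
    show "\<bar>f x - q (h x)\<bar> \<le> e" if "x \<in> K" for x
      using qh[of x] h(2)[OF that] B(1)[OF that] unfolding c_def by linarith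
  qed
qed

lemma borel_measure_tight:
  fixes M :: "'a::euclidean_space measure"
  assumes "prob_space M" "sets M = sets borel" "0 < e"
  obtains R where "measure M {x. norm x > R} < e"
proof -
  interpret prob_space M by (rule assms)
  have m: "{x. norm x > R} \<in> sets M" for R :: real
    unfolding assms(2) by measurable
  have "(\<lambda>n. prob {x. norm x > real n}) \<longlonglongrightarrow> prob (\<Inter>n. {x. norm x > real n})"
    by (rule finite_Lim_measure_decseq) (auto simp: m decseq_def)
  also have "(\<Inter>n. {x :: 'a. norm x > real n}) = {}"
    by (simp add: set_eq_iff not_less real_arch_simple)
  finally have "(\<lambda>n. prob {x. norm x > real n}) \<longlonglongrightarrow> 0" by simp
  then have "\<forall>\<^sub>F n in sequentially. prob {x. norm x > real n} < e"
    using assms(3) by (simp add: order_tendsto_iff)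
  then show ?thesis using that eventually_happens'[OF sequentially_bot] by blast
qed

text \<open>Tightness is assumed here because the application gets it directly from Chebyshev's
  inequality. It confines all laws to one ball up to small mass; there a bounded continuous function
  is replaced by a trigonometric polynomial with almost the same global bound, whose integrals
  converge by linearity from the waves.\<close>

theorem levy_continuity_pmf:
  fixes \<nu> :: "nat \<Rightarrow> (real^'n) pmf" and \<mu> :: "(real^'n) measure"
  assumes \<mu>: "prob_space \<mu>" "sets \<mu> = sets borel"
    and wave: "\<And>t b. (\<lambda>n. measure_pmf.expectation (\<nu> n) (\<lambda>x. cos (t \<bullet> x + b)))
                 \<longlonglongrightarrow> integral\<^sup>L \<mu> (\<lambda>x. cos (t \<bullet> x + b))"
    and tight: "\<And>e. 0 < e \<Longrightarrow> \<exists>R. \<forall>\<^sub>F n in sequentially. measure_pmf.prob (\<nu> n) {x. norm x > R} \<le> e"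
  shows "conv_law (\<lambda>n. measure_pmf (\<nu> n)) \<mu>"
  unfolding conv_law_def
proof (intro allI impI)
  fix f :: "real^'n \<Rightarrow> real"
  assume "continuous_on UNIV f \<and> bounded (range f)"
  then obtain B where f: "continuous_on UNIV f" and fB: "\<And>x. \<bar>f x\<bar> \<le> B" and B: "B > 0"
    by (auto simp: bounded_pos)
  interpret prob_space \<mu> by (rule \<mu>)
  have int: "integrable \<mu> g" if "continuous_on UNIV g" "\<And>x. \<bar>g x\<bar> \<le> C" for g :: "real^'n \<Rightarrow> real" and C
    using that \<mu>(2) borel_measurable_continuous_onI[OF that(1)]
    by (intro integrable_const_bound[of _ C]) (auto simp: measurable_cong_sets[OF \<mu>(2) refl])
  have intp: "integrable (measure_pmf p) g" if "\<And>x. \<bar>g x\<bar> \<le> C" for g :: "real^'n \<Rightarrow> real" and C p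
    using that by (intro measure_pmf.integrable_const_bound[of _ C]) auto
  have trig: "(\<lambda>n. measure_pmf.expectation (\<nu> n) g) \<longlonglongrightarrow> integral\<^sup>L \<mu> g" if "g \<in> trig_poly" for g
    using that
  proof induction
    case (wave t b)
    show ?case by (rule assms(3))
  next
    case (scale g c)
    then show ?case by (auto intro!: tendsto_intros)
  next
    case (add g h)
    obtain C where C: "\<And>x. \<bar>g x\<bar> \<le> C"
      using bounded_trig_poly[OF add.hyps(1)] by blast
    obtain D where D: "\<And>x. \<bar>h x\<bar> \<le> D"
      using bounded_trig_poly[OF add.hyps(2)] by blast
    note int[OF continuous_on_trig_poly[OF add.hyps(1)] C] int[OF continuous_on_trig_poly[OF add.hyps(2)] D]
      intp[OF C] intp[OF D]
    with add.IH show ?case by (auto intro!: tendsto_intros)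
  qed
  show "(\<lambda>n. measure_pmf.expectation (\<nu> n) f) \<longlonglongrightarrow> integral\<^sup>L \<mu> f"
  proof (rule tendstoI)
    fix e :: real assume e: "0 < e"
    \<comment> \<open>The three errors sum to
      \<open>2 * (d + (2 * B + 1) * d) + d = (4 * B + 5) * d\<close>, strictly below
      \<open>(4 * B + 8) * d\<close>. The bound \<open>d \<le> 1\<close> gives
      \<open>2 * B + 1\<close> as a bound for the difference of \<open>f\<close> and
      \<open>g\<close>.\<close>
    define d where "d = min 1 (e / (4 * B + 8))"
    have d: "0 < d" "d \<le> 1" "d \<le> e / (4 * B + 8)"
      using e B by (auto simp: d_def)
    then have dB: "(4 * B + 8) * d \<le> e"
      using B by (simp add: pos_le_divide_eq mult.commute)
    obtain R1 where R1: "\<forall>\<^sub>F n in sequentially. measure_pmf.prob (\<nu> n) {x. norm x > R1} \<le> d"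
      using tight[OF d(1)] by blast
    obtain R2 where R2: "prob {x. norm x > R2} < d"
      by (rule borel_measure_tight[OF \<mu> d(1)])
    \<comment> \<open>One ball that carries almost all mass both of the limit and of eventually
      every \<open>\<nu> n\<close>.\<close>
    define R where "R = max R1 R2"
    have m: "{x. norm x > r} \<in> sets \<mu>" for r :: real
      unfolding \<mu>(2) by measurable
    obtain g where g: "g \<in> trig_poly" "\<And>x. x \<in> cball 0 R \<Longrightarrow> \<bar>f x - g x\<bar> \<le> d" "\<And>x. \<bar>g x\<bar> \<le> B + d"
      using trig_poly_approx[of "cball 0 R" f B d] continuous_on_subset[OF f] fB B d by auto
    have fg: "\<bar>f x - g x\<bar> \<le> 2 * B + 1" for x
      using fB[of x] g(3)[of x] d by linarith
    have near: "\<bar>f x - g x\<bar> \<le> d" if "x \<notin> {x. norm x > R}" for x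
      using g(2)[of x] that by auto
    have lim: "\<bar>integral\<^sup>L \<mu> f - integral\<^sup>L \<mu> g\<bar> \<le> d + (2 * B + 1) * d"
    proof -
      have "\<bar>integral\<^sup>L \<mu> f - integral\<^sup>L \<mu> g\<bar> \<le> d + (2 * B + 1) * prob {x. norm x > R}"
        using fg near d int[OF f fB] int[OF continuous_on_trig_poly[OF g(1)] g(3)] m
        by (intro expectation_diff_le) auto
      also have "prob {x. norm x > R} \<le> prob {x. norm x > R2}"
        by (rule finite_measure_mono) (auto simp: m R_def)
      also note less_imp_le[OF R2]
      finally show ?thesis using B by (simp add: mult_left_mono)
    qed
    have "\<forall>\<^sub>F n in sequentially. dist (measure_pmf.expectation (\<nu> n) g) (integral\<^sup>L \<mu> g) < d"
      using trig[OF g(1)] d(1) by (rule tendstoD)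
    with R1 show "\<forall>\<^sub>F n in sequentially. dist (measure_pmf.expectation (\<nu> n) f) (integral\<^sup>L \<mu> f) < e"
    proof eventually_elim
      case (elim n)
      have "\<bar>measure_pmf.expectation (\<nu> n) f - measure_pmf.expectation (\<nu> n) g\<bar>
          \<le> d + (2 * B + 1) * measure_pmf.prob (\<nu> n) {x. norm x > R}"
        using fg near d intp[OF fB] intp[OF g(3)]
        by (intro measure_pmf.expectation_diff_le) auto
      also have "measure_pmf.prob (\<nu> n) {x. norm x > R} \<le> measure_pmf.prob (\<nu> n) {x. norm x > R1}"
        by (rule measure_pmf.finite_measure_mono) (auto simp: R_def)
      also note elim(1)
      finally have "\<bar>measure_pmf.expectation (\<nu> n) f - measure_pmf.expectation (\<nu> n) g\<bar> \<le> d + (2 * B + 1) * d"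
        using B by (simp add: mult_left_mono)
      with lim elim(2) have "dist (measure_pmf.expectation (\<nu> n) f) (integral\<^sup>L \<mu> f) < 2 * (d + (2 * B + 1) * d) + d"
        unfolding dist_real_def by (auto simp: abs_le_iff abs_less_iff)
      also have "\<dots> \<le> (4 * B + 8) * d"
        using d(1) by (simp add: algebra_simps)
      finally show ?case using dB by linarith
    qed
  qed
qed

section \<open>Gaussian vectors\<close>

text \<open>For positive \<open>v\<close> the law is the image of the standard normal law under
  multiplication by \<open>sqrt v\<close>; for \<open>v = 0\<close> it is the point mass at 0, whose
  characteristic function is 1.\<close>

lemma char_normal0:
  assumes "0 \<le> v"
  shows "char (normal0 v) s = exp (- (s\<^sup>2 * v / 2))"
proof (cases "v = 0")
  case True
  then show ?thesis by (simp add: normal0_def char_def integral_return)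
next
  case False
  define a where "a = sqrt v"
  have a: "a > 0" "a\<^sup>2 = v" using False assms by (auto simp: a_def)
  interpret N: prob_space std_normal_distribution by (rule prob_space_normal_density) simp
  have "distributed std_normal_distribution lborel (\<lambda>x. x) std_normal_density"
    by (simp add: distributed_def distr_id2)
  then have "distributed std_normal_distribution lborel (\<lambda>x. 0 + a * x) (normal_density (0 + a * 0) (\<bar>a\<bar> * 1))"
    using a by (intro N.normal_density_affine) auto
  then have "density lborel (normal_density 0 a) = distr std_normal_distribution lborel (\<lambda>x. a * x)"
    using a by (simp add: distributed_def)
  also have "\<dots> = distr std_normal_distribution borel (\<lambda>x. a * x)"
    by (rule distr_cong) auto
  finally have "normal0 v = distr std_normal_distribution borel (\<lambda>x. a * x)"
    using False by (simp add: normal0_def a_def)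
  then have "char (normal0 v) s = char std_normal_distribution (s * a)"
    by (simp add: char_def integral_distr mult.assoc)
  then show ?thesis
    using a by (simp add: char_std_normal_distribution power_mult_distrib)
qed

lemma real_distribution_normal0:
  assumes "0 \<le> v" shows "real_distribution (normal0 v)"
proof (cases "v = 0")
  case True
  then show ?thesis
    by (auto simp: normal0_def real_distribution_def real_distribution_axioms_def intro!: prob_space_return)
next
  case False
  then show ?thesis using assms
    by (auto simp: normal0_def real_distribution_def real_distribution_axioms_def intro!: prob_space_normal_density)
qed

text \<open>The vector is \<open>\<Sum>i\<in>I. \<xi> i *\<^sub>R b i\<close> with independent
  standard normal \<open>\<xi> i\<close> on a product space. Prescribing the covariance through the
  vectors \<open>b i\<close> avoids taking a square root of a matrix; the law of each projection is
  identified by its characteristic function.\<close>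

lemma gaussian_vector_exists:
  fixes b :: "'i \<Rightarrow> real^'n"
  assumes "finite I"
  obtains \<mu> :: "(real^'n) measure" where "prob_space \<mu>" "sets \<mu> = sets borel"
    "\<And>t. distr \<mu> borel (\<lambda>z. t \<bullet> z) = normal0 (\<Sum>i\<in>I. (t \<bullet> b i)\<^sup>2)"
proof -
  let ?N = "std_normal_distribution"
  define P where "P = (\<Pi>\<^sub>M i\<in>I. ?N)"
  have N: "prob_space ?N" by (rule prob_space_normal_density) simp
  interpret prob_space P unfolding P_def by (rule prob_space_PiM[OF N])
  have coord[measurable]: "(\<lambda>\<xi>. \<xi> i) \<in> borel_measurable P" if "i \<in> I" for i
    using measurable_component_singleton[OF that, of "\<lambda>_. ?N"] by (simp add: P_def cong: measurable_cong_sets)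
  have dist_coord: "distr P borel (\<lambda>\<xi>. \<xi> i) = ?N" if "i \<in> I" for i
  proof -
    have "distr P borel (\<lambda>\<xi>. \<xi> i) = distr P ?N (\<lambda>\<xi>. \<xi> i)" by (rule distr_cong) auto
    then show ?thesis unfolding P_def using distr_PiM_component[of I "\<lambda>_. ?N", OF N that] by simp
  qed
  define X where "X \<xi> = (\<Sum>i\<in>I. \<xi> i *\<^sub>R b i)" for \<xi>
  have X[measurable]: "X \<in> borel_measurable P" unfolding X_def by measurable
  have indep: "indep_vars (\<lambda>_. borel) (\<lambda>i \<xi>. a i * \<xi> i) I"
    if "I \<noteq> {}" for a :: "'i \<Rightarrow> real"
  proof -
    have "indep_vars (\<lambda>_. ?N) (\<lambda>i \<xi>. \<xi> i) I"
    proof (subst indep_vars_iff_distr_eq_PiM')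
      show "I \<noteq> {}" by (rule that)
      show "random_variable ?N (\<lambda>\<xi>. \<xi> i)" if "i \<in> I" for i
        using that unfolding P_def by (rule measurable_component_singleton)
      have "distr P P (\<lambda>\<xi>. \<lambda>i\<in>I. \<xi> i) = distr P P (\<lambda>\<xi>. \<xi>)"
        by (rule distr_cong) (auto simp: P_def space_PiM PiE_def extensional_restrict)
      also have "\<dots> = P" by (rule distr_id2) simp
      also have "\<dots> = (\<Pi>\<^sub>M i\<in>I. distr P ?N (\<lambda>\<xi>. \<xi> i))"
        unfolding P_def by (rule PiM_cong) (auto simp: distr_PiM_component[of I "\<lambda>_. ?N", OF N])
      finally show "distr P (\<Pi>\<^sub>M i\<in>I. ?N) (\<lambda>\<xi>. \<lambda>i\<in>I. \<xi> i) = (\<Pi>\<^sub>M i\<in>I. distr P ?N (\<lambda>\<xi>. \<xi> i))"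
        by (simp add: P_def)
    qed
    then show ?thesis by (rule indep_vars_compose2) auto
  qed
  show ?thesis
  proof (rule that[of "distr P borel X"])
    show "prob_space (distr P borel X)" by (rule prob_space_distr) measurable
    show "sets (distr P borel X) = sets borel" by simp
    fix t
    let ?v = "\<Sum>i\<in>I. (t \<bullet> b i)\<^sup>2"
    have v: "0 \<le> ?v" by (simp add: sum_nonneg)
    have eq: "distr (distr P borel X) borel (\<lambda>z. t \<bullet> z) = distr P borel (\<lambda>\<xi>. \<Sum>i\<in>I. (t \<bullet> b i) * \<xi> i)"
      by (subst distr_distr) (auto simp: comp_def X_def inner_sum_right mult.commute)
    have "char (distr P borel (\<lambda>\<xi>. \<Sum>i\<in>I. (t \<bullet> b i) * \<xi> i)) s = char (normal0 ?v) s" for s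
    proof -
      have "char (distr P borel (\<lambda>\<xi>. \<Sum>i\<in>I. (t \<bullet> b i) * \<xi> i)) s
          = (\<Prod>i\<in>I. char (distr P borel (\<lambda>\<xi>. (t \<bullet> b i) * \<xi> i)) s)"
      \<comment> \<open>The criterion for independence is stated for a nonempty index set; for an
        empty one the sum is the constant 0 and the product is 1.\<close>
      proof (cases "I = {}")
        case True
        then show ?thesis by (simp add: char_def integral_distr prob_space del: distr_const)
      next
        case False
        then show ?thesis by (intro char_distr_sum indep)
      qed
      also have "\<dots> = (\<Prod>i\<in>I. char (distr P borel (\<lambda>\<xi>. \<xi> i)) (s * (t \<bullet> b i)))"
        by (intro prod.cong refl) (simp add: char_def integral_distr mult.assoc)
      also have "\<dots> = (\<Prod>i\<in>I. complex_of_real (exp (- ((s * (t \<bullet> b i))\<^sup>2) / 2)))"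
        by (intro prod.cong refl) (simp add: dist_coord char_std_normal_distribution)
      also have "\<dots> = complex_of_real (exp (\<Sum>i\<in>I. - ((s * (t \<bullet> b i))\<^sup>2) / 2))"
        by (simp add: exp_sum[OF assms])
      also have "(\<Sum>i\<in>I. - ((s * (t \<bullet> b i))\<^sup>2) / 2) = - (s\<^sup>2 * ?v / 2)"
        by (simp add: power_mult_distrib sum_distrib_left sum_negf sum_divide_distrib)
      finally show ?thesis by (simp add: char_normal0[OF v])
    qed
    then have "distr P borel (\<lambda>\<xi>. \<Sum>i\<in>I. (t \<bullet> b i) * \<xi> i) = normal0 ?v"
      by (intro Levy_uniqueness real_distribution_distr real_distribution_normal0[OF v] ext) measurable
    then show "distr (distr P borel X) borel (\<lambda>z. t \<bullet> z) = normal0 ?v"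
      unfolding eq .
  qed
qed

section \<open>Multinomial distributions\<close>

lemma
  assumes nonneg: "\<And>j. j \<in> {1..L+1} \<Longrightarrow> 0 \<le> p j" and sum1: "(\<Sum>j=1..L+1. p j) = 1"
  shows set_cat_pmf: "set_pmf (cat_pmf L p) \<subseteq> {1..L+1}"
    and pmf_cat_pmf: "j \<in> {1..L+1} \<Longrightarrow> pmf (cat_pmf L p) j = p j"
proof -
  define xs where "xs = map (\<lambda>j. (j, p j)) [1..<L+2]"
  have set: "set [1..<L+2] = {1..L+1}" by auto
  have "sum_list (map snd xs) = sum p (set [1..<L+2])"
    unfolding xs_def by (simp add: comp_def sum_list_distinct_conv_sum_set del: upt_Suc)
  then have "sum_list (map snd xs) = 1" unfolding set using sum1 by simp
  then have wf: "pmf_of_list_wf xs"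
    using nonneg by (intro pmf_of_list_wfI) (auto simp: xs_def simp del: upt_Suc)
  show "set_pmf (cat_pmf L p) \<subseteq> {1..L+1}"
    using set_pmf_of_list[OF wf] unfolding cat_pmf_def xs_def by (auto simp del: upt_Suc)
  assume j: "j \<in> {1..L+1}"
  have "sum_list (map snd (filter (\<lambda>z. fst z = j) xs)) = sum_list (map p (filter (\<lambda>i. i = j) [1..<L+2]))"
    unfolding xs_def by (simp add: filter_map comp_def del: upt_Suc)
  also have "\<dots> = sum p (set (filter (\<lambda>i. i = j) [1..<L+2]))"
    by (rule sum_list_distinct_conv_sum_set) (simp del: upt_Suc)
  also have "set (filter (\<lambda>i. i = j) [1..<L+2]) = {j}"
    using j by (auto simp del: upt_Suc)
  finally show "pmf (cat_pmf L p) j = p j"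
    using pmf_pmf_of_list[OF wf, of j] by (simp add: cat_pmf_def xs_def)
qed

lemma finite_set_multinomial_pmf:
  assumes "finite (set_pmf c)"
  shows "finite (set_pmf (multinomial_pmf n c))"
  using assms by (induction n) auto

text \<open>Conditioning on the first \<open>n\<close> observations. The finite support of
  \<open>c\<close> turns both integrals into finite sums, so \<open>h\<close> may be
  arbitrary.\<close>

lemma expectation_multinomial_Suc:
  fixes h :: "(nat \<Rightarrow> nat) \<Rightarrow> 'b::{banach, second_countable_topology}"
  assumes "finite (set_pmf c)"
  shows "measure_pmf.expectation (multinomial_pmf (Suc n) c) h =
    measure_pmf.expectation (multinomial_pmf n c) (\<lambda>v. measure_pmf.expectation c (\<lambda>j. h (v(j := Suc (v j)))))"
proof -
  note fin = finite_set_multinomial_pmf[OF assms, of n]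
  show ?thesis
    unfolding multinomial_pmf.simps
    by (subst pmf_expectation_bind[OF fin])
      (auto simp: assms integral_measure_pmf[OF fin] )
qed

text \<open>If one further observation in cell \<open>j\<close> multiplies \<open>h\<close> by
  \<open>g j\<close>, then \<open>h\<close> is a product over independent observations. With
  \<open>h\<close> an exponential of a linear form this gives the characteristic function of the
  counts as an \<open>n\<close>-th power.\<close>

lemma expectation_multinomial_multiplicative:
  fixes h :: "(nat \<Rightarrow> nat) \<Rightarrow> complex"
  assumes "finite (set_pmf c)" "h (\<lambda>_. 0) = 1"
    and "\<And>v j. j \<in> set_pmf c \<Longrightarrow> h (v(j := Suc (v j))) = h v * g j"
  shows "measure_pmf.expectation (multinomial_pmf n c) h = measure_pmf.expectation c g ^ n"
proof (induction n)
  case 0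
  then show ?case using assms(2) by simp
next
  case (Suc n)
  have "measure_pmf.expectation c (\<lambda>j. h (v(j := Suc (v j)))) = h v * measure_pmf.expectation c g" for v
  proof -
    have "measure_pmf.expectation c (\<lambda>j. h (v(j := Suc (v j)))) = measure_pmf.expectation c (\<lambda>j. h v * g j)"
      using assms(3) by (intro integral_cong_AE) (auto simp: AE_measure_pmf_iff)
    then show ?thesis by simp
  qed
  then show ?case using Suc by (simp add: expectation_multinomial_Suc[OF assms(1)] del: multinomial_pmf.simps)
qed

text \<open>The centred linear form in the counts is a sum of \<open>n\<close> independent copies of
  the centred \<open>d\<close>, so each observation adds the same variance.\<close>

lemma variance_multinomial:
  fixes c :: "nat pmf" and d :: "nat \<Rightarrow> real"
  assumes A: "finite A" "set_pmf c \<subseteq> A"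
  defines "m \<equiv> measure_pmf.expectation c d"
  shows "measure_pmf.expectation (multinomial_pmf n c) (\<lambda>v. ((\<Sum>i\<in>A. d i * real (v i)) - real n * m)\<^sup>2)
    = real n * measure_pmf.variance c d"
proof -
  define S where "S n v = (\<Sum>i\<in>A. d i * real (v i)) - real n * m" for n and v :: "nat \<Rightarrow> nat"
  have fin: "finite (set_pmf c)" using A finite_subset by blast
  have int: "integrable (measure_pmf c) f" for f :: "nat \<Rightarrow> real"
    by (rule integrable_measure_pmf_finite[OF fin])
  have intm: "integrable (measure_pmf (multinomial_pmf n c)) f" for f :: "_ \<Rightarrow> real" and n
    by (rule integrable_measure_pmf_finite[OF finite_set_multinomial_pmf[OF fin]])
  have S: "S (Suc n) (v(j := Suc (v j))) = S n v + (d j - m)" if "j \<in> set_pmf c" for n v j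
  proof -
    have j: "j \<in> A" using that A by blast
    have "(\<Sum>i\<in>A. d i * real ((v(j := Suc (v j))) i)) = (\<Sum>i\<in>A. d i * real (v i) + (if i = j then d i else 0))"
      by (intro sum.cong) (auto simp: algebra_simps)
    also have "\<dots> = (\<Sum>i\<in>A. d i * real (v i)) + d j"
      using j A(1) by (simp add: sum.distrib)
    finally show ?thesis by (simp add: S_def algebra_simps)
  qed
  have cong: "measure_pmf.expectation c (\<lambda>j. f (S (Suc n) (v(j := Suc (v j))))) = measure_pmf.expectation c (\<lambda>j. f (S n v + (d j - m)))"
    for f :: "real \<Rightarrow> real" and n v
    using S by (intro integral_cong_AE) (auto simp: AE_measure_pmf_iff)
  have mean: "measure_pmf.expectation (multinomial_pmf n c) (S n) = 0" for n
  proof (induction n)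
    case 0
    then show ?case by (simp add: S_def)
  next
    case (Suc n)
    have "measure_pmf.expectation c (\<lambda>j. S n v + (d j - m)) = S n v" for v
      using int by (simp add: m_def)
    then show ?case
      using Suc cong[of "\<lambda>x. x"] by (simp add: expectation_multinomial_Suc[OF fin] del: multinomial_pmf.simps)
  qed
  have "measure_pmf.expectation (multinomial_pmf n c) (\<lambda>v. (S n v)\<^sup>2) = real n * measure_pmf.variance c d"
  proof (induction n)
    case 0
    then show ?case by (simp add: S_def)
  next
    case (Suc n)
    have "measure_pmf.expectation c (\<lambda>j. (S n v + (d j - m))\<^sup>2) = (S n v)\<^sup>2 + measure_pmf.variance c d" for v
    proof -
      \<comment> \<open>The cross term integrates to 0 over the new observation, because
        \<open>m\<close> is the mean of \<open>d\<close> under \<open>c\<close>.\<close>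
      have "(\<lambda>j. (S n v + (d j - m))\<^sup>2) = (\<lambda>j. (S n v)\<^sup>2 + 2 * S n v * (d j - m) + (d j - m)\<^sup>2)"
        by (auto simp: fun_eq_iff power2_eq_square algebra_simps)
      then show ?thesis using int by (simp add: m_def)
    qed
    then show ?case
      using Suc cong[of "\<lambda>x. x\<^sup>2"] intm
      by (simp add: expectation_multinomial_Suc[OF fin] algebra_simps del: multinomial_pmf.simps)
  qed
  then show ?thesis by (simp add: S_def)
qed

text \<open>The central limit theorem for a centred law on finitely many points. Taylor's formula
  puts the base within order \<open>n powr (-3/2)\<close> of \<open>1 - s / (2 * n)\<close>, and for
  numbers in the unit disc the distance of \<open>n\<close>-th powers is at most \<open>n\<close>
  times the distance of the bases, so an error of order \<open>1 / sqrt n\<close> remains.\<close>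

lemma iexp_average_power_tendsto:
  fixes p d :: "'i \<Rightarrow> real"
  assumes A: "finite A" and p: "\<And>j. j \<in> A \<Longrightarrow> 0 \<le> p j" "(\<Sum>j\<in>A. p j) = 1" and d: "(\<Sum>j\<in>A. p j * d j) = 0"
  shows "(\<lambda>n. (\<Sum>j\<in>A. p j * iexp (d j / sqrt (real n))) ^ n)
    \<longlonglongrightarrow> complex_of_real (exp (- ((\<Sum>j\<in>A. p j * (d j)\<^sup>2) / 2)))"
proof -
  define s where "s = (\<Sum>j\<in>A. p j * (d j)\<^sup>2)"
  define C where "C = (\<Sum>j\<in>A. p j * \<bar>d j\<bar> ^ 3 / 6)"
  define z where "z n = (\<Sum>j\<in>A. p j * iexp (d j / sqrt (real n)))" for n
  have s0: "s \<ge> 0" unfolding s_def using p by (intro sum_nonneg) auto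
  have z1: "norm (z n) \<le> 1" for n
  proof -
    have "norm (z n) \<le> (\<Sum>j\<in>A. norm (p j * iexp (d j / sqrt (real n))))" unfolding z_def by (rule norm_sum)
    also have "\<dots> = (\<Sum>j\<in>A. p j)" using p by (intro sum.cong) (auto simp: norm_mult)
    finally show ?thesis using p by simp
  qed
  have taylor: "norm (iexp x - (1 + \<i> * x - complex_of_real (x\<^sup>2 / 2))) \<le> \<bar>x\<bar> ^ 3 / 6" for x :: real
    using iexp_approx1[of x 2]
    by (simp add: numeral_eq_Suc power_mult_distrib algebra_simps)
  have approx: "norm (z n - complex_of_real (1 + (- s / 2) / n)) \<le> C / (n * sqrt n)" if "n > 0" for n :: nat
  proof -
    let ?x = "\<lambda>j. d j / sqrt (real n)"
    have sq: "(?x j)\<^sup>2 = (d j)\<^sup>2 / n" for j using that by (simp add: power_divide)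
    have cube: "\<bar>?x j\<bar> ^ 3 = \<bar>d j\<bar> ^ 3 / (n * sqrt n)" for j
      using that by (simp add: power_divide power3_eq_cube)
    define R where "R j = iexp (?x j) - (1 + \<i> * ?x j - complex_of_real ((?x j)\<^sup>2 / 2))" for j
    have R: "norm (R j) \<le> \<bar>?x j\<bar> ^ 3 / 6" for j
      unfolding R_def by (rule taylor)
    have "(\<Sum>j\<in>A. p j * (1 + \<i> * ?x j - complex_of_real ((?x j)\<^sup>2 / 2)))
        = complex_of_real (\<Sum>j\<in>A. p j) + \<i> * complex_of_real ((\<Sum>j\<in>A. p j * d j) / sqrt n) - complex_of_real (s / n / 2)"
      unfolding s_def sq
      by (simp add: algebra_simps sum.distrib sum_subtractf sum_distrib_left sum_divide_distrib)
    also have "\<dots> = complex_of_real (1 + (- s / 2) / n)" by (simp add: p d)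
    finally have "z n - complex_of_real (1 + (- s / 2) / n)
        = (\<Sum>j\<in>A. p j * R j)"
      unfolding z_def R_def by (simp only: right_diff_distrib sum_subtractf)
    also have "norm \<dots> \<le> (\<Sum>j\<in>A. norm (p j * R j))"
      by (rule norm_sum)
    also have "\<dots> \<le> (\<Sum>j\<in>A. p j * (\<bar>?x j\<bar> ^ 3 / 6))"
    proof (rule sum_mono)
      fix j assume j: "j \<in> A"
      have "norm (p j * R j) = p j * norm (R j)" using p(1)[OF j] by (simp add: norm_mult)
      also have "\<dots> \<le> p j * (\<bar>?x j\<bar> ^ 3 / 6)" using R p(1)[OF j] by (rule mult_left_mono)
      finally show "norm (p j * R j) \<le> p j * (\<bar>?x j\<bar> ^ 3 / 6)" .
    qed
    also have "\<dots> = C / (n * sqrt n)"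
      unfolding cube C_def by (simp add: sum_divide_distrib mult.commute)
    finally show ?thesis .
  qed
  have main: "\<forall>\<^sub>F n in sequentially. norm (z n ^ n - complex_of_real ((1 + (- s / 2) / n) ^ n)) \<le> C / sqrt n"
    \<comment> \<open>For \<open>n \<ge> s\<close> the real base \<open>1 - s / (2 * n)\<close> lies
      in the unit disc, as the comparison of powers requires.\<close>
    using eventually_ge_at_top[of "nat \<lceil>s\<rceil> + 1"]
  proof eventually_elim
    case (elim n)
    then have n: "n > 0" "real n \<ge> s" by linarith+
    then have w: "\<bar>1 + (- s / 2) / n\<bar> \<le> 1" using s0 by (auto simp: abs_le_iff field_simps)
    have "norm (z n ^ n - complex_of_real (1 + (- s / 2) / n) ^ n) \<le> n * norm (z n - complex_of_real (1 + (- s / 2) / n))"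
      using w by (intro norm_power_diff z1) (simp only: norm_of_real)
    also have "\<dots> \<le> n * (C / (n * sqrt n))" using approx[OF n(1)] by (intro mult_left_mono) auto
    also have "\<dots> = C / sqrt n" using n by simp
    finally show ?case by simp
  qed
  have "(\<lambda>n. C / sqrt (real n)) \<longlonglongrightarrow> 0"
    by (intro tendsto_divide_0[OF tendsto_const] filterlim_at_top_imp_at_infinity
        filterlim_compose[OF sqrt_at_top filterlim_real_sequentially])
  then have "(\<lambda>n. z n ^ n - complex_of_real ((1 + (- s / 2) / n) ^ n)) \<longlonglongrightarrow> 0"
    by (rule Lim_null_comparison[OF main])
  moreover have "(\<lambda>n. complex_of_real ((1 + (- s / 2) / n) ^ n)) \<longlonglongrightarrow> complex_of_real (exp (- s / 2))"
    by (intro tendsto_of_real tendsto_exp_limit_sequentially)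
  ultimately have "(\<lambda>n. z n ^ n) \<longlonglongrightarrow> complex_of_real (exp (- s / 2))"
    by (rule Lim_transform[rotated])
  then show ?thesis by (simp add: z_def s_def)
qed

lemma multinomial_iexp_tendsto:
  fixes p a :: "nat \<Rightarrow> real"
  assumes p: "\<And>j. j \<in> {1..L+1} \<Longrightarrow> 0 \<le> p j" "(\<Sum>j=1..L+1. p j) = 1"
  defines "m \<equiv> \<Sum>j=1..L+1. p j * a j"
  shows "(\<lambda>n. measure_pmf.expectation (multinomial_pmf n (cat_pmf L p))
            (\<lambda>v. iexp (\<Sum>j=1..L+1. a j * (sqrt (real n) * (real (v j) / real n - p j)))))
    \<longlonglongrightarrow> complex_of_real (exp (- ((\<Sum>j=1..L+1. p j * (a j - m)\<^sup>2) / 2)))"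
proof (rule Lim_transform_eventually)
  let ?c = "cat_pmf L p" and ?A = "{1..L+1}"
  show "(\<lambda>n. (\<Sum>j\<in>?A. p j * iexp ((a j - m) / sqrt (real n))) ^ n)
      \<longlonglongrightarrow> complex_of_real (exp (- ((\<Sum>j=1..L+1. p j * (a j - m)\<^sup>2) / 2)))"
  proof (rule iexp_average_power_tendsto)
    show "(\<Sum>j\<in>?A. p j * (a j - m)) = 0"
      by (simp add: right_diff_distrib sum_subtractf flip: sum_distrib_right) (use p m_def in simp)
  qed (use p in auto)
  note c = set_cat_pmf[OF p] pmf_cat_pmf[OF p]
  have fin: "finite (set_pmf ?c)" using c(1) finite_subset by blast
  show "\<forall>\<^sub>F n in sequentially. (\<Sum>j\<in>?A. p j * iexp ((a j - m) / sqrt (real n))) ^ n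
     = measure_pmf.expectation (multinomial_pmf n ?c)
        (\<lambda>v. iexp (\<Sum>j=1..L+1. a j * (sqrt (real n) * (real (v j) / real n - p j))))"
    using eventually_gt_at_top[of 0]
  proof eventually_elim
    case (elim n)
    let ?s = "sqrt (real n)"
    define h where "h v = iexp ((\<Sum>j\<in>?A. a j * real (v j)) / ?s)" for v :: "nat \<Rightarrow> nat"
    have n: "?s * ?s = real n" "?s > 0" using elim by auto
    \<comment> \<open>The centring \<open>n * m\<close> is shared equally among the \<open>n\<close>
      observations, so that each contributes the centred factor \<open>iexp ((a j - m) / ?s)\<close>
      to an \<open>n\<close>-th power.\<close>
    have split: "iexp ((x - n * m) / ?s) = iexp (x / ?s) * iexp (- m / ?s) ^ n" for x
      by (simp add: exp_of_nat_mult[symmetric] exp_add[symmetric] diff_divide_distrib algebra_simps)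
    have eq: "iexp (\<Sum>j=1..L+1. a j * (?s * (real (v j) / real n - p j))) = h v * iexp (- m / ?s) ^ n" for v
    proof -
      have "?s * (real (v j) / real n - p j) = (real (v j) - n * p j) / ?s" for j
        using n elim by (simp add: field_simps flip: power2_eq_square)
      then have "(\<Sum>j=1..L+1. a j * (?s * (real (v j) / real n - p j)))
          = (\<Sum>j=1..L+1. a j * (real (v j) - n * p j)) / ?s"
        by (simp add: sum_divide_distrib del: sum.cl_ivl_Suc)
      also have "(\<Sum>j=1..L+1. a j * (real (v j) - n * p j)) = (\<Sum>j\<in>?A. a j * real (v j)) - n * m"
        unfolding m_def sum_distrib_left sum_subtractf[symmetric] by (intro sum.cong) (auto simp: algebra_simps)
      finally show ?thesis unfolding h_def split[symmetric] by (rule arg_cong)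
    qed
    have "measure_pmf.expectation (multinomial_pmf n ?c) h = measure_pmf.expectation ?c (\<lambda>j. iexp (a j / ?s)) ^ n"
    proof (rule expectation_multinomial_multiplicative[OF fin])
      show "h (\<lambda>_. 0) = 1" by (simp add: h_def)
      fix v j assume "j \<in> set_pmf ?c"
      then have j: "j \<in> ?A" using c by blast
      have "(\<Sum>i\<in>?A. a i * real ((v(j := Suc (v j))) i)) = (\<Sum>i\<in>?A. a i * real (v i) + (if i = j then a i else 0))"
        by (intro sum.cong) (auto simp: algebra_simps)
      also have "\<dots> = (\<Sum>i\<in>?A. a i * real (v i)) + a j"
        using j by (simp add: sum.distrib del: sum.cl_ivl_Suc)
      finally show "h (v(j := Suc (v j))) = h v * iexp (a j / ?s)"
        by (simp add: h_def add_divide_distrib exp_add[symmetric] algebra_simps del: sum.cl_ivl_Suc)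
    qed
    also have "measure_pmf.expectation ?c (\<lambda>j. iexp (a j / ?s)) = (\<Sum>j\<in>?A. pmf ?c j *\<^sub>R iexp (a j / ?s))"
      by (rule integral_measure_pmf) (use c(1) in auto)
    also have "\<dots> = (\<Sum>j\<in>?A. p j * iexp (a j / ?s))"
      by (intro sum.cong refl) (simp only: c(2) scaleR_conv_of_real)
    finally have "measure_pmf.expectation (multinomial_pmf n ?c) h * iexp (- m / ?s) ^ n
        = ((\<Sum>j\<in>?A. p j * iexp (a j / ?s)) * iexp (- m / ?s)) ^ n"
      by (simp add: power_mult_distrib)
    also have "(\<Sum>j\<in>?A. p j * iexp (a j / ?s)) * iexp (- m / ?s) = (\<Sum>j\<in>?A. p j * iexp ((a j - m) / ?s))"
      unfolding sum_distrib_right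
      by (intro sum.cong) (auto simp: mult.assoc exp_add[symmetric] diff_divide_distrib algebra_simps)
    finally show ?case unfolding eq by simp
  qed
qed

section \<open>Roots of perturbed equations\<close>

text \<open>The Newton map with the derivative frozen at \<open>z0\<close> sends a ball of radius
  proportional to \<open>\<delta> q\<close> into itself. Brouwer's theorem asks only for continuity
  of that map, not for a contraction, so a first-order expansion at the single point
  \<open>z0\<close> is enough. The parameter \<open>q\<close> enters only through its size
  \<open>\<delta> q\<close> and its first-order effect \<open>c q\<close>.\<close>

lemma implicit_root_expansion:
  fixes H :: "'a::euclidean_space \<Rightarrow> 'q \<Rightarrow> 'a" and \<delta> :: "'q \<Rightarrow> real" and c :: "'q \<Rightarrow> 'a"
  assumes B: "linear B" "linear B'" "\<And>x. B' (B x) = x"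
    and \<delta>: "\<And>q. 0 \<le> \<delta> q" "(\<delta> \<longlongrightarrow> 0) G"
    and c: "\<And>q. norm (c q) \<le> K * \<delta> q" "0 \<le> K"
    and U: "open U" "z0 \<in> U" "\<And>q. continuous_on U (\<lambda>z. H z q)"
    and expand: "\<And>e. 0 < e \<Longrightarrow> \<forall>\<^sub>F (z, q) in nhds z0 \<times>\<^sub>F G.
                   norm (H z q - B (z - z0) - c q) \<le> e * (norm (z - z0) + \<delta> q)"
  obtains E where "\<forall>\<^sub>F q in G. H (E q) q = 0"
    and "\<And>e. 0 < e \<Longrightarrow> \<forall>\<^sub>F q in G. norm (E q - z0 + B' (c q)) \<le> e * \<delta> q"
proof -
  obtain b where b: "b > 0" "\<And>y. norm (B' y) \<le> b * norm y"
    using linear_bounded_pos[OF B(2)] by blast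
  \<comment> \<open>In finite dimension a left inverse is also a right inverse; this later turns a
    fixed point of the Newton map into a root.\<close>
  have BB': "B (B' y) = y" for y
    using linear_inverse_left[OF B(1,2)] B(3) by (metis comp_apply eq_id_iff)
  \<comment> \<open>Large enough that \<open>b * K * \<delta> q + (\<rho> q + \<delta> q) / 4 \<le>
    \<rho> q\<close>, the bound that makes the ball invariant.\<close>
  define \<rho> where "\<rho> q = (2 * b * K + 1) * \<delta> q" for q
  have \<rho>0: "0 \<le> \<rho> q" for q using b c \<delta> by (simp add: \<rho>_def)
  have \<rho>_lim: "(\<rho> \<longlongrightarrow> 0) G"
    unfolding \<rho>_def by (rule tendsto_mult_right_zero[OF \<delta>(2)])
  \<comment> \<open>The radii tend to 0, so eventually the whole ball lies in the neighbourhood of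
    \<open>z0\<close> on which the expansion holds.\<close>
  have near: "\<forall>\<^sub>F q in G. \<forall>z\<in>cball z0 (\<rho> q). norm (H z q - B (z - z0) - c q) \<le> e * (norm (z - z0) + \<delta> q)"
    if e: "0 < e" for e
  proof -
    obtain Q1 Q2 where Q: "eventually Q1 (nhds z0)" "eventually Q2 G"
      "\<And>z q. Q1 z \<Longrightarrow> Q2 q \<Longrightarrow> norm (H z q - B (z - z0) - c q) \<le> e * (norm (z - z0) + \<delta> q)"
      using expand[OF e] unfolding eventually_prod_filter by auto
    obtain r where r: "r > 0" "\<And>z. dist z z0 < r \<Longrightarrow> Q1 z"
      using Q(1) unfolding eventually_nhds_metric by blast
    have "\<forall>\<^sub>F q in G. \<rho> q < r"
      using \<rho>_lim r(1) by (simp add: order_tendsto_iff)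
    with Q(2) show ?thesis
    proof eventually_elim
      case (elim q)
      then show ?case using Q(3) r(2) by (auto simp: dist_commute)
    qed
  qed
  obtain r0 where r0: "r0 > 0" "cball z0 r0 \<subseteq> U"
    using U open_contains_cball by blast
  have U_near: "\<forall>\<^sub>F q in G. cball z0 (\<rho> q) \<subseteq> U"
  proof -
    have "\<forall>\<^sub>F q in G. \<rho> q < r0"
      using \<rho>_lim r0(1) by (simp add: order_tendsto_iff)
    then show ?thesis
      by eventually_elim (use r0(2) in auto)
  qed
  \<comment> \<open>With this precision the remainder, after applying \<open>B'\<close> of norm at
    most \<open>b\<close>, is at most a quarter of
    \<open>norm (z - z0) + \<delta> q\<close>.\<close>
  have b4: "0 < 1 / (4 * b)" using b by simp
  have ex: "\<forall>\<^sub>F q in G. \<exists>z\<in>cball z0 (\<rho> q). H z q = 0"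
    using near[OF b4] U_near
  proof eventually_elim
    case (elim q)
    define T where "T z = z - B' (H z q)" for z
    have T: "T z \<in> cball z0 (\<rho> q)" if z: "z \<in> cball z0 (\<rho> q)" for z
    proof -
      define R where "R = H z q - B (z - z0) - c q"
      have "H z q = B (z - z0) + c q + R" by (simp add: R_def)
      then have "B' (H z q) = z - z0 + B' (c q) + B' R"
        using B by (simp add: linear_add)
      then have "T z - z0 = - (B' (c q) + B' R)"
        unfolding T_def by simp
      then have "norm (T z - z0) \<le> norm (B' (c q)) + norm (B' R)"
        by (metis norm_minus_cancel norm_triangle_ineq)
      also have "\<dots> \<le> b * (K * \<delta> q) + b * (1 / (4 * b) * (norm (z - z0) + \<delta> q))"
        using elim(1) z b c(1)[of q] unfolding R_def
        by (intro add_mono order_trans[OF b(2)] mult_left_mono) auto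
      also have "\<dots> = b * K * \<delta> q + (norm (z - z0) + \<delta> q) / 4"
        using b by (simp add: field_simps)
      also have "\<dots> \<le> b * K * \<delta> q + (\<rho> q + \<delta> q) / 4"
        using z by (simp add: dist_norm norm_minus_commute)
      also have "\<dots> \<le> \<rho> q"
        using b c(2) \<delta>(1)[of q] by (simp add: \<rho>_def algebra_simps)
      finally show ?thesis by (simp add: dist_norm norm_minus_commute)
    qed
    have "continuous_on (cball z0 (\<rho> q)) T"
      unfolding T_def
      by (intro continuous_intros linear_continuous_on_compose[OF _ B(2)] continuous_on_subset[OF U(3)] elim(2))
    then obtain z where z: "z \<in> cball z0 (\<rho> q)" "T z = z"
      using brouwer[of "cball z0 (\<rho> q)" T] T \<rho>0[of q] by auto
    from z(2) have "B (B' (H z q)) = B 0" by (simp add: T_def)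
    then have "H z q = 0" using B(1) by (simp add: BB' linear_0)
    with z(1) show ?case by blast
  qed
  define E where "E q = (SOME z. z \<in> cball z0 (\<rho> q) \<and> H z q = 0)" for q
  have E: "E q \<in> cball z0 (\<rho> q) \<and> H (E q) q = 0" if "\<exists>z\<in>cball z0 (\<rho> q). H z q = 0" for q
    using someI_ex[of "\<lambda>z. z \<in> cball z0 (\<rho> q) \<and> H z q = 0"] that unfolding E_def by blast
  show ?thesis
  proof (rule that[of E])
    show "\<forall>\<^sub>F q in G. H (E q) q = 0"
      using ex by eventually_elim (use E in blast)
    fix e :: real assume e: "0 < e"
    \<comment> \<open>A root in the ball satisfies \<open>norm (E q - z0) + \<delta> q \<le> (2 * b
      * K + 2) * \<delta> q\<close>, and applying \<open>B'\<close> costs a further factor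
      \<open>b\<close>.\<close>
    define e' where "e' = e / (b * (2 * b * K + 2))"
    have p: "b * (2 * b * K + 2) > 0" using b c(2) by (simp add: add_nonneg_pos)
    have e': "e' > 0" "e' * (b * (2 * b * K + 2)) = e" using e p by (auto simp: e'_def)
    show "\<forall>\<^sub>F q in G. norm (E q - z0 + B' (c q)) \<le> e * \<delta> q"
      using near[OF e'(1)] ex
    proof eventually_elim
      case (elim q)
      note Eq = E[OF elim(2)]
      define R where "R = H (E q) q - B (E q - z0) - c q"
      have R: "norm R \<le> e' * (norm (E q - z0) + \<delta> q)"
        using elim(1) Eq unfolding R_def by blast
      have "B (E q - z0) + c q = - R" using Eq by (simp add: R_def)
      then have "B' (B (E q - z0) + c q) = - B' R" using B(2) by (simp add: linear_neg)
      then have "E q - z0 + B' (c q) = - B' R" using B by (simp add: linear_add)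
      then have "norm (E q - z0 + B' (c q)) = norm (B' R)" by simp
      also have "\<dots> \<le> b * (e' * (norm (E q - z0) + \<delta> q))"
        using R b by (intro order_trans[OF b(2)] mult_left_mono) auto
      also have "\<dots> \<le> b * (e' * (\<rho> q + \<delta> q))"
        using Eq b e' by (intro mult_left_mono add_right_mono) (auto simp: dist_norm norm_minus_commute)
      also have "\<dots> = (e' * (b * (2 * b * K + 2))) * \<delta> q"
        by (simp add: \<rho>_def algebra_simps)
      finally show ?case unfolding e'(2) .
    qed
  qed
qed

text \<open>In the product rule the term with a derivative of \<open>g\<close> would be multiplied
  by \<open>f x = 0\<close>, so continuity of \<open>g\<close> at \<open>x\<close> suffices. This is
  how the estimating equations are differentiated at the true parameter without second derivatives
  of the cell probabilities.\<close>

lemma (in bounded_bilinear) has_derivative_zero_factor: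
  assumes f: "(f has_derivative f') (at x)" "f x = 0" and g: "isCont g x"
  shows "((\<lambda>y. prod (g y) (f y)) has_derivative (\<lambda>h. prod (g x) (f' h))) (at x)"
proof -
  interpret f': bounded_linear f' by (rule has_derivative_bounded_linear[OF f(1)])
  obtain K where K: "K > 0" "\<And>a b. norm (prod a b) \<le> norm a * norm b * K"
    using pos_bounded by blast
  obtain N where N: "N > 0" "\<And>h. norm (f' h) \<le> norm h * N"
    using f'.pos_bounded by blast
  have "\<forall>\<^sub>F y in at x. norm (prod (g y) (f y) - prod (g x) (f x) - prod (g x) (f' (y - x))) \<le> e * norm (y - x)"
    if e: "0 < e" for e
  proof -
    define C where "C = K * (norm (g x) + 1 + N)"
    have C: "C > 0" using K N by (simp add: C_def add_nonneg_pos)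
    \<comment> \<open>The bound 1 keeps \<open>norm (g y)\<close> below
      \<open>norm (g x) + 1\<close>; the bound \<open>e / C\<close> makes the two remainders
      together at most \<open>e * norm (y - x)\<close>.\<close>
    define d where "d = min 1 (e / C)"
    have d: "0 < d" "d \<le> 1" "d \<le> e / C"
      using e C by (auto simp: d_def)
    then have dC: "d * C \<le> e" using C by (simp add: pos_le_divide_eq)
    have "\<forall>\<^sub>F y in at x. norm (f y - f x - f' (y - x)) \<le> d * norm (y - x)"
      using f(1) d(1) unfolding has_derivative_within_alt2 by blast
    moreover have "\<forall>\<^sub>F y in at x. norm (g y - g x) < d"
      using g d(1) unfolding isCont_def tendsto_iff dist_norm by blast
    ultimately show ?thesis
    proof eventually_elim
      case (elim y)
      let ?h = "y - x"
      have gy: "norm (g y) \<le> norm (g x) + 1"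
        using elim(2) d norm_triangle_sub[of "g y" "g x"] by linarith
      have "prod (g y) (f y) - prod (g x) (f x) - prod (g x) (f' ?h)
          = prod (g y) (f y - f x - f' ?h) + prod (g y - g x) (f' ?h)"
        by (simp add: f(2) diff_right diff_left zero_right)
      also have "norm \<dots> \<le> norm (g y) * norm (f y - f x - f' ?h) * K + norm (g y - g x) * norm (f' ?h) * K"
        by (intro norm_triangle_le add_mono K)
      also have "\<dots> \<le> (norm (g x) + 1) * (d * norm ?h) * K + d * (norm ?h * N) * K"
        using K N d elim gy by (intro add_mono mult_right_mono mult_mono) auto
      also have "\<dots> = (d * C) * norm ?h" by (simp add: C_def algebra_simps)
      also have "\<dots> \<le> e * norm ?h" using dC by (intro mult_right_mono) auto
      finally show ?case .
    qed
  qed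
  then show ?thesis
    unfolding has_derivative_within_alt2
    using bounded_linear_compose[OF bounded_linear_right[of "g x"] f'.bounded_linear_axioms] by auto
qed

section \<open>Linear algebra and the distance of frequency vectors for the estimating
  equations\<close>

lemma bounded_bilinear_matrix_vector_mult:
  "bounded_bilinear ((*v) :: real^'m^'n \<Rightarrow> real^'m \<Rightarrow> real^'n)"
  unfolding bilinear_conv_bounded_bilinear[symmetric] bilinear_def
  by (auto intro!: linearI simp: matrix_vector_mult_add_rdistrib matrix_vector_right_distrib
      matrix_vector_mult_scaleR scaleR_matrix_vector_assoc)

lemma matrix_inv_vector_cancel:
  fixes A :: "real^'n^'n"
  assumes "invertible A"
  shows "matrix_inv A *v (A *v x) = x"
proof -
  have "matrix_inv A ** A = mat 1"
    using someI_ex[OF assms[unfolded invertible_def]] unfolding matrix_inv_def by blast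
  then show ?thesis by (simp add: matrix_vector_mul_assoc)
qed

text \<open>Frequencies are functions on all of \<open>nat\<close>, but only the cells
  \<open>1..L+1\<close> carry meaning. The filter pulled back along this pseudometric therefore
  replaces the neighbourhood filter of a function space.\<close>

definition l1_dev :: "nat \<Rightarrow> (nat \<Rightarrow> real) \<Rightarrow> (nat \<Rightarrow> real) \<Rightarrow> real" where
  "l1_dev L p q = (\<Sum>j=1..L+1. \<bar>q j - p j\<bar>)"

abbreviation nhds_l1 :: "nat \<Rightarrow> (nat \<Rightarrow> real) \<Rightarrow> (nat \<Rightarrow> real) filter" where
  "nhds_l1 L p \<equiv> filtercomap (l1_dev L p) (nhds 0)"

lemma l1_dev_nonneg: "0 \<le> l1_dev L p q"
  unfolding l1_dev_def by (intro sum_nonneg) auto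

lemma norm_sum_scaleR_l1_dev:
  assumes "\<And>j. j \<in> {1..L+1} \<Longrightarrow> norm (a j) \<le> e"
  shows "norm (\<Sum>j=1..L+1. (q j - p j) *\<^sub>R a j) \<le> e * l1_dev L p q"
proof -
  have "norm (\<Sum>j=1..L+1. (q j - p j) *\<^sub>R a j) \<le> (\<Sum>j=1..L+1. norm ((q j - p j) *\<^sub>R a j))"
    by (rule norm_sum)
  also have "\<dots> \<le> (\<Sum>j=1..L+1. \<bar>q j - p j\<bar> * e)"
    unfolding norm_scaleR using assms by (intro sum_mono mult_left_mono) auto
  also have "\<dots> = e * l1_dev L p q"
    by (simp only: l1_dev_def sum_distrib_left mult.commute)
  finally show ?thesis .
qed

text \<open>This sum of rank-one maps is the shape in which \<open>J\<close> arises, up to sign, on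
  differentiating the estimating equations.\<close>

lemma Jmat_mult_vec:
  "Jmat \<beta> L p w *v h = (\<Sum>j=1..L+1. (w j \<bullet> h) *\<^sub>R (p j powr (\<beta> - 1) *\<^sub>R w j))"
proof (subst vec_eq_iff, intro allI)
  fix a
  have "(Jmat \<beta> L p w *v h) $ a = (\<Sum>b\<in>UNIV. \<Sum>j=1..L+1. w j $ a * p j powr (\<beta> - 1) * w j $ b * h $ b)"
    unfolding matrix_vector_mult_def Jmat_def by (simp add: sum_distrib_right del: sum.cl_ivl_Suc)
  also have "\<dots> = (\<Sum>j=1..L+1. \<Sum>b\<in>UNIV. w j $ a * p j powr (\<beta> - 1) * w j $ b * h $ b)"
    by (rule sum.swap)
  also have "\<dots> = (\<Sum>j=1..L+1. (w j \<bullet> h) *\<^sub>R (p j powr (\<beta> - 1) *\<^sub>R w j)) $ a"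
    by (simp add: inner_vec_def sum_distrib_left sum_distrib_right algebra_simps del: sum.cl_ivl_Suc)
  finally show "(Jmat \<beta> L p w *v h) $ a = (\<Sum>j=1..L+1. (w j \<bullet> h) *\<^sub>R (p j powr (\<beta> - 1) *\<^sub>R w j)) $ a" .
qed

text \<open>The unknown is \<open>(\<theta>, \<lambda>)\<close>. At \<open>(\<theta>\<^sub>0, 0)\<close> the term \<open>M \<theta> *v \<lambda>\<close> is differentiable although \<open>M\<close> is only
  continuous, because its second factor vanishes there.\<close>

lemma rmdpde_root_expansion:
  fixes p :: "real^3 \<Rightarrow> nat \<Rightarrow> real" and w :: "real^3 \<Rightarrow> nat \<Rightarrow> real^3"
    and m :: "real^3 \<Rightarrow> real^'r" and M :: "real^3 \<Rightarrow> real^'r^3" and \<theta>0 :: "real^3" and L :: nat and \<beta> :: real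
  defines "J \<equiv> Jmat \<beta> L (p \<theta>0) (w \<theta>0)"
  defines "Q \<equiv> matrix_inv J ** M \<theta>0 ** matrix_inv (transpose (M \<theta>0) ** matrix_inv J ** M \<theta>0)"
  defines "P \<equiv> matrix_inv J - Q ** transpose (M \<theta>0) ** matrix_inv J"
  assumes U: "open U" "\<theta>0 \<in> U"
    and p_pos: "\<And>j \<theta>. j \<in> {1..L+1} \<Longrightarrow> \<theta> \<in> U \<Longrightarrow> 0 < p \<theta> j"
    and p_deriv: "\<And>j \<theta>. j \<in> {1..L+1} \<Longrightarrow> \<theta> \<in> U \<Longrightarrow> ((\<lambda>\<theta>. p \<theta> j) has_derivative (\<lambda>h. w \<theta> j \<bullet> h)) (at \<theta>)"
    and w_cont: "\<And>j. j \<in> {1..L+1} \<Longrightarrow> continuous_on U (\<lambda>\<theta>. w \<theta> j)"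
    and m_deriv: "\<And>\<theta>. \<theta> \<in> U \<Longrightarrow> (m has_derivative (\<lambda>h. transpose (M \<theta>) *v h)) (at \<theta>)"
    and M_cont: "continuous_on U M" and m0: "m \<theta>0 = 0"
    and J_inv: "invertible J" and S_inv: "invertible (transpose (M \<theta>0) ** matrix_inv J ** M \<theta>0)"
  obtains E where "\<forall>\<^sub>F q in nhds_l1 L (p \<theta>0). \<exists>lam. rmdpde_eqs \<beta> L p w m M q (E q) lam"
    and "\<And>e. 0 < e \<Longrightarrow> \<forall>\<^sub>F q in nhds_l1 L (p \<theta>0).
      norm (E q - \<theta>0 - (\<Sum>j=1..L+1. (q j - p \<theta>0 j) *\<^sub>R (P *v (p \<theta>0 j powr (\<beta> - 1) *\<^sub>R w \<theta>0 j))))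
      \<le> e * l1_dev L (p \<theta>0) q"
proof -
  interpret mv: bounded_bilinear "(*v) :: real^'r^3 \<Rightarrow> real^'r \<Rightarrow> real^3"
    by (rule bounded_bilinear_matrix_vector_mult)
  let ?G = "nhds_l1 L (p \<theta>0)" and ?\<delta> = "l1_dev L (p \<theta>0)" and ?A = "{1..L+1}"
  define M0 where "M0 = M \<theta>0"
  define S where "S = transpose M0 ** matrix_inv J ** M0"
  define a where "a \<theta> j = p \<theta> j powr (\<beta> - 1) *\<^sub>R w \<theta> j" for \<theta> j
  define H where "H z q = ((\<Sum>j\<in>?A. (q j - p (fst z) j) *\<^sub>R a (fst z) j) + M (fst z) *v snd z, m (fst z))"
    for z :: "(real^3) \<times> (real^'r)" and q
  define z0 where "z0 = (\<theta>0, 0 :: real^'r)"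
  \<comment> \<open>The derivative of \<open>H\<close> at \<open>z0\<close>: the bordered matrix
    with blocks \<open>- J\<close>, \<open>M0\<close>, \<open>transpose M0\<close> and 0. Its
    inverse \<open>B'\<close> comes from eliminating the parameter part: \<open>lag\<close> solves
    for the multiplier with the Schur complement \<open>S\<close>.\<close>
  define B where "B z = (M0 *v snd z - J *v fst z, transpose M0 *v fst z)" for z :: "(real^3) \<times> (real^'r)"
  define lag where "lag z = matrix_inv S *v (snd z + transpose M0 *v (matrix_inv J *v fst z))"
    for z :: "(real^3) \<times> (real^'r)"
  define B' where "B' z = (matrix_inv J *v (M0 *v lag z - fst z), lag z)" for z
  define c where "c q = (\<Sum>j\<in>?A. (q j - p \<theta>0 j) *\<^sub>R a \<theta>0 j, 0 :: real^'r)" for q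
  define K where "K = (\<Sum>j\<in>?A. norm (a \<theta>0 j))"
  note [simp del] = sum.cl_ivl_Suc transpose_matrix_vector
  have p_cont: "continuous_on U (\<lambda>\<theta>. p \<theta> j)" if "j \<in> ?A" for j
    using has_derivative_continuous[OF p_deriv[OF that]] by (blast intro: continuous_at_imp_continuous_on)
  have a_cont: "continuous_on U (\<lambda>\<theta>. a \<theta> j)" if "j \<in> ?A" for j
    unfolding a_def using p_pos[OF that]
    by (intro continuous_intros p_cont w_cont that) fastforce
  have m_cont: "continuous_on U m"
    using has_derivative_continuous[OF m_deriv] by (blast intro: continuous_at_imp_continuous_on)
  have isCont_fst: "isCont (\<lambda>z. f (fst z)) z0" if "continuous_on U f" for f :: "real^3 \<Rightarrow> 'z::topological_space"
  proof -
    have "isCont f (fst z0)" using that U by (simp add: z0_def continuous_on_eq_continuous_at)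
    then show ?thesis by (intro isCont_o2[of _ fst f] continuous_intros)
  qed
  have deriv_fst: "((\<lambda>z. f (fst z)) has_derivative (\<lambda>h. f' (fst h))) (at z0)"
    if "(f has_derivative f') (at \<theta>0)" for f f' :: "real^3 \<Rightarrow> 'z::real_normed_vector"
    by (rule has_derivative_compose[of fst fst]) (use that in \<open>auto simp: z0_def intro!: derivative_intros\<close>)
  have H_deriv: "((\<lambda>z. H z (p \<theta>0)) has_derivative B) (at z0)"
  proof -
    \<comment> \<open>At \<open>q = p \<theta>0\<close> the scalar factor vanishes at
      \<open>z0\<close>, so the merely continuous \<open>a\<close> is not differentiated.\<close>
    have 1: "((\<lambda>z. (p \<theta>0 j - p (fst z) j) *\<^sub>R a (fst z) j) has_derivative (\<lambda>h. (- (w \<theta>0 j \<bullet> fst h)) *\<^sub>R a \<theta>0 j)) (at z0)"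
      if "j \<in> ?A" for j
    proof -
      have "((\<lambda>z. p \<theta>0 j - p (fst z) j) has_derivative (\<lambda>h. - (w \<theta>0 j \<bullet> fst h))) (at z0)"
        using deriv_fst[OF p_deriv[OF that U(2)]] by (auto intro!: derivative_eq_intros)
      from bounded_bilinear.has_derivative_zero_factor[OF bounded_bilinear.flip[OF bounded_bilinear_scaleR] this _ isCont_fst[OF a_cont[OF that]]]
      show ?thesis by (simp add: z0_def)
    qed
    have 2: "((\<lambda>z. M (fst z) *v snd z) has_derivative (\<lambda>h. M0 *v snd h)) (at z0)"
      using mv.has_derivative_zero_factor[OF bounded_linear_imp_has_derivative[OF bounded_linear_snd] _ isCont_fst[OF M_cont]]
      by (simp add: z0_def M0_def)
    have 3: "((\<lambda>z. m (fst z)) has_derivative (\<lambda>h. transpose M0 *v fst h)) (at z0)"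
      using deriv_fst[OF m_deriv[OF U(2)]] by (simp add: M0_def)
    have "B = (\<lambda>h. ((\<Sum>j\<in>?A. (- (w \<theta>0 j \<bullet> fst h)) *\<^sub>R a \<theta>0 j) + M0 *v snd h, transpose M0 *v fst h))"
      by (simp add: B_def J_def Jmat_mult_vec a_def fun_eq_iff sum_negf)
    then show ?thesis unfolding H_def
      using 1 2 3 by (auto intro!: has_derivative_Pair has_derivative_add has_derivative_sum)
  qed
  have Jc: "matrix_inv J *v (J *v h) = h" for h by (rule matrix_inv_vector_cancel[OF J_inv])
  have Sc: "matrix_inv S *v (S *v l) = l" for l
    using S_inv unfolding S_def M0_def by (rule matrix_inv_vector_cancel)
  have Sv: "S *v l = transpose M0 *v (matrix_inv J *v (M0 *v l))" for l
    by (simp add: S_def matrix_vector_mul_assoc matrix_mul_assoc)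
  have B'B: "B' (B z) = z" for z
  proof -
    have "lag (B z) = matrix_inv S *v (S *v snd z)"
      unfolding lag_def B_def by (simp add: matrix_vector_mult_diff_distrib Jc Sv)
    then have l: "lag (B z) = snd z" by (simp add: Sc)
    show ?thesis unfolding B'_def l by (simp add: B_def Jc)
  qed
  have lin: "linear B" "linear B'"
    unfolding B_def B'_def lag_def
    by (auto intro!: linearI simp: algebra_simps matrix_vector_right_distrib matrix_vector_mult_scaleR matrix_vector_mult_diff_distrib)
  have norm_c: "norm (c q) \<le> K * ?\<delta> q" for q
  proof -
    have "norm (c q) = norm (\<Sum>j\<in>?A. (q j - p \<theta>0 j) *\<^sub>R a \<theta>0 j)" by (simp add: c_def norm_Pair)
    also have "\<dots> \<le> K * ?\<delta> q"
      by (rule norm_sum_scaleR_l1_dev) (unfold K_def, rule member_le_sum, auto)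
    finally show ?thesis .
  qed
  have expand: "\<forall>\<^sub>F (z, q) in nhds z0 \<times>\<^sub>F ?G. norm (H z q - B (z - z0) - c q) \<le> e * (norm (z - z0) + ?\<delta> q)"
    if e: "0 < e" for e
  proof -
    have H0: "H z0 (p \<theta>0) = 0" by (simp add: H_def z0_def m0 zero_prod_def)
    have "\<forall>\<^sub>F z in nhds z0. norm (H z (p \<theta>0) - B (z - z0)) \<le> e * norm (z - z0)"
      using H_deriv e H0 unfolding has_derivative_at_alt eventually_nhds_metric dist_norm by fastforce
    moreover have "\<forall>\<^sub>F z in nhds z0. \<forall>j\<in>?A. norm (a (fst z) j - a \<theta>0 j) \<le> e"
    proof (intro eventually_ball_finite ballI finite_atLeastAtMost)
      fix j assume j: "j \<in> ?A"
      have "((\<lambda>z. a (fst z) j) \<longlongrightarrow> a \<theta>0 j) (nhds z0)"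
        using isCont_fst[OF a_cont[OF j], unfolded isCont_def, THEN tendsto_at_iff_tendsto_nhds[THEN iffD1]]
        by (simp add: z0_def)
      then have "\<forall>\<^sub>F z in nhds z0. dist (a (fst z) j) (a \<theta>0 j) < e" using e by (rule tendstoD)
      then show "\<forall>\<^sub>F z in nhds z0. norm (a (fst z) j - a \<theta>0 j) \<le> e"
        by eventually_elim (simp add: dist_norm)
    qed
    \<comment> \<open>Since \<open>H\<close> is affine in \<open>q\<close>, moving \<open>q\<close>
      away from \<open>p \<theta>0\<close> adds, beyond \<open>c q\<close>, only the sum with
      coefficients \<open>a (fst z) j - a \<theta>0 j\<close>; its bound is uniform in
      \<open>q\<close>.\<close>
    ultimately have "\<forall>\<^sub>F z in nhds z0. \<forall>q. norm (H z q - B (z - z0) - c q) \<le> e * (norm (z - z0) + ?\<delta> q)"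
    proof eventually_elim
      case (elim z)
      show ?case
      proof
        fix q
        have lin_q: "norm (\<Sum>j\<in>?A. (q j - p \<theta>0 j) *\<^sub>R (a (fst z) j - a \<theta>0 j)) \<le> e * ?\<delta> q"
          using elim(2) by (intro norm_sum_scaleR_l1_dev) blast
        have "H z q - B (z - z0) - c q = (H z (p \<theta>0) - B (z - z0))
            + (\<Sum>j\<in>?A. (q j - p \<theta>0 j) *\<^sub>R (a (fst z) j - a \<theta>0 j), 0)"
          by (simp add: H_def c_def algebra_simps sum_subtractf sum.distrib)
        also have "norm \<dots> \<le> e * norm (z - z0) + e * ?\<delta> q"
          using elim(1) lin_q by (intro norm_triangle_le add_mono) (simp_all add: norm_Pair)
        finally show "norm (H z q - B (z - z0) - c q) \<le> e * (norm (z - z0) + ?\<delta> q)"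
          by (simp add: distrib_left)
      qed
    qed
    then have "\<forall>\<^sub>F x in nhds z0 \<times>\<^sub>F ?G. \<forall>q. norm (H (fst x) q - B (fst x - z0) - c q) \<le> e * (norm (fst x - z0) + ?\<delta> q)"
      by (rule eventually_compose_filterlim[OF _ filterlim_fst])
    then show ?thesis by eventually_elim auto
  qed
  have "\<exists>E. (\<forall>\<^sub>F q in ?G. H (E q) q = 0) \<and>
      (\<forall>e>0. \<forall>\<^sub>F q in ?G. norm (E q - z0 + B' (c q)) \<le> e * ?\<delta> q)"
  proof (rule implicit_root_expansion[OF lin B'B l1_dev_nonneg filterlim_filtercomap norm_c _ _ _ _ expand])
    show "0 \<le> K" unfolding K_def by (rule sum_nonneg) auto
    show "open (U \<times> (UNIV :: (real^'r) set))" using U by (simp add: open_Times)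
    show "z0 \<in> U \<times> UNIV" using U by (simp add: z0_def)
    show "continuous_on (U \<times> UNIV) (\<lambda>z. H z q)" for q
      unfolding H_def
      by (intro continuous_intros mv.continuous_on continuous_on_compose2[OF p_cont] continuous_on_compose2[OF a_cont]
          continuous_on_compose2[OF M_cont] continuous_on_compose2[OF m_cont]) auto
  qed blast+
  then obtain E where E: "\<forall>\<^sub>F q in ?G. H (E q) q = 0"
      "\<And>e. 0 < e \<Longrightarrow> \<forall>\<^sub>F q in ?G. norm (E q - z0 + B' (c q)) \<le> e * ?\<delta> q" by blast
  \<comment> \<open>The upper left block of the inverse bordered matrix is \<open>- P\<close>: this
    is where the matrix of the asymptotic covariance comes from.\<close>
  have P: "fst (B' (u, 0)) = - (P *v u)" for u
    unfolding B'_def lag_def P_def Q_def S_def M0_def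
    by (simp add: matrix_vector_mult_diff_distrib matrix_vector_mult_diff_rdistrib matrix_vector_mul_assoc matrix_mul_assoc)
  show ?thesis
  proof (rule that[of "\<lambda>q. fst (E q)"])
    show "\<forall>\<^sub>F q in ?G. \<exists>lam. rmdpde_eqs \<beta> L p w m M q (fst (E q)) lam"
      using E(1)
    proof eventually_elim
      case (elim q)
      define \<theta> where "\<theta> = fst (E q)"
      have eq: "(\<Sum>j\<in>?A. (q j - p \<theta> j) *\<^sub>R a \<theta> j) + M \<theta> *v snd (E q) = 0" and m: "m \<theta> = 0"
        using elim by (simp_all add: H_def \<theta>_def zero_prod_def)
      have "(\<Sum>j\<in>?A. w \<theta> j $ i * p \<theta> j powr (\<beta> - 1) * (q j - p \<theta> j)) + (M \<theta> *v snd (E q)) $ i = 0" for i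
        using arg_cong[OF eq, of "\<lambda>v. v $ i"] by (simp add: a_def mult_ac)
      with m show ?case unfolding rmdpde_eqs_def \<theta>_def by blast
    qed
    fix e :: real assume "0 < e"
    from E(2)[OF this] show "\<forall>\<^sub>F q in ?G. norm (fst (E q) - \<theta>0 - (\<Sum>j=1..L+1. (q j - p \<theta>0 j) *\<^sub>R (P *v (p \<theta>0 j powr (\<beta> - 1) *\<^sub>R w \<theta>0 j))))
      \<le> e * ?\<delta> q"
    proof eventually_elim
      case (elim q)
      have "(\<Sum>j=1..L+1. (q j - p \<theta>0 j) *\<^sub>R (P *v (p \<theta>0 j powr (\<beta> - 1) *\<^sub>R w \<theta>0 j)))
          = P *v (\<Sum>j\<in>?A. (q j - p \<theta>0 j) *\<^sub>R a \<theta>0 j)"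
        unfolding a_def linear_sum[OF matrix_vector_mul_linear] matrix_vector_mult_scaleR ..
      then have "fst (E q) - \<theta>0 - (\<Sum>j=1..L+1. (q j - p \<theta>0 j) *\<^sub>R (P *v (p \<theta>0 j powr (\<beta> - 1) *\<^sub>R w \<theta>0 j)))
          = fst (E q - z0 + B' (c q))"
        by (simp add: c_def P z0_def)
      also have "norm \<dots> \<le> norm (E q - z0 + B' (c q))" by (metis norm_fst_le prod.collapse)
      finally show ?case using elim by linarith
    qed
  qed
qed

section \<open>The delta method for multinomial frequencies\<close>

text \<open>Chebyshev's inequality with a constant independent of \<open>n\<close>: each count has
  variance \<open>n * V j\<close>, and the square of a sum of \<open>L+1\<close> terms is at most
  \<open>L+1\<close> times the sum of their squares.\<close>

lemma multinomial_l1_dev_tail: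
  assumes p: "\<And>j. j \<in> {1..L+1} \<Longrightarrow> 0 \<le> p j" "(\<Sum>j=1..L+1. p j) = 1"
  obtains C where "0 \<le> C"
    "\<And>n R. 0 < n \<Longrightarrow> 0 < R \<Longrightarrow> measure_pmf.prob (multinomial_pmf n (cat_pmf L p))
        {v. R \<le> sqrt (real n) * l1_dev L p (\<lambda>j. real (v j) / real n)} \<le> C / R\<^sup>2"
proof -
  let ?c = "cat_pmf L p" and ?A = "{1..L+1}"
  note [simp del] = sum.cl_ivl_Suc
  have c: "set_pmf ?c \<subseteq> ?A" "\<And>j. j \<in> ?A \<Longrightarrow> pmf ?c j = p j"
    using set_cat_pmf[OF p] pmf_cat_pmf[OF p] by blast+
  have fin: "finite (set_pmf ?c)" using c(1) finite_subset by blast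
  have int: "integrable (measure_pmf (multinomial_pmf n ?c)) f" for f :: "_ \<Rightarrow> real" and n
    by (rule integrable_measure_pmf_finite[OF finite_set_multinomial_pmf[OF fin]])
  define V where "V j = measure_pmf.variance ?c (indicator {j} :: nat \<Rightarrow> real)" for j
  define C where "C = (\<Sum>j\<in>?A. V j) * card ?A"
  have "V j \<ge> 0" for j unfolding V_def by (rule measure_pmf.variance_positive)
  then have C0: "C \<ge> 0" unfolding C_def by (intro mult_nonneg_nonneg sum_nonneg) auto
  have var: "measure_pmf.expectation (multinomial_pmf n ?c) (\<lambda>v. (real (v j) - real n * p j)\<^sup>2) = real n * V j"
    if j: "j \<in> ?A" for j n
  proof -
    have "measure_pmf.expectation ?c (indicator {j}) = p j"
      using c(2)[OF j] by (simp add: pmf.rep_eq)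
    moreover have "(\<Sum>i\<in>?A. indicator {j} i * real (v i)) = real (v j)" for v
      using j by (simp add: indicator_def)
    ultimately show ?thesis
      using variance_multinomial[OF _ c(1), where d = "indicator {j}" and n = n] by (simp add: V_def)
  qed
  show ?thesis
  proof (rule that[OF C0])
    fix n :: nat and R :: real assume n: "0 < n" and R: "0 < R"
    let ?M = "multinomial_pmf n ?c" and ?\<delta> = "\<lambda>v. l1_dev L p (\<lambda>j. real (v j) / real n)"
    have le: "(sqrt n * ?\<delta> v)\<^sup>2 \<le> (\<Sum>j\<in>?A. (real (v j) - n * p j)\<^sup>2) * card ?A / n" for v
    proof -
      have "n * ?\<delta> v = (\<Sum>j\<in>?A. \<bar>real (v j) - n * p j\<bar>)"
        unfolding l1_dev_def sum_distrib_left
      proof (rule sum.cong[OF refl])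
        fix j
        have "real (v j) - n * p j = n * (real (v j) / n - p j)" using n by (simp add: right_diff_distrib)
        then show "n * \<bar>real (v j) / n - p j\<bar> = \<bar>real (v j) - n * p j\<bar>" by (simp only: abs_mult abs_of_nat)
      qed
      then have "(n * ?\<delta> v)\<^sup>2 \<le> (\<Sum>j\<in>?A. (real (v j) - n * p j)\<^sup>2) * card ?A"
        using sum_squared_le_sum_of_squares[of "\<lambda>j. \<bar>real (v j) - n * p j\<bar>" ?A] by simp
      moreover have "(sqrt n * ?\<delta> v)\<^sup>2 = (n * ?\<delta> v)\<^sup>2 / n"
        using n by (simp add: power_mult_distrib power2_eq_square)
      ultimately show ?thesis using n by (simp add: divide_right_mono)
    qed
    have "measure_pmf.expectation ?M (\<lambda>v. (sqrt n * ?\<delta> v)\<^sup>2)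
        \<le> measure_pmf.expectation ?M (\<lambda>v. (\<Sum>j\<in>?A. (real (v j) - n * p j)\<^sup>2) * card ?A / n)"
      by (intro integral_mono int le)
    also have "\<dots> = (\<Sum>j\<in>?A. n * V j) * card ?A / n"
      using int by (simp add: var)
    also have "\<dots> = C" using n by (simp add: C_def flip: sum_distrib_left)
    finally have E: "measure_pmf.expectation ?M (\<lambda>v. (sqrt n * ?\<delta> v)\<^sup>2) \<le> C" .
    have "measure_pmf.prob ?M {v. R \<le> sqrt n * ?\<delta> v} \<le> measure_pmf.prob ?M {v\<in>UNIV. R\<^sup>2 \<le> (sqrt n * ?\<delta> v)\<^sup>2}"
      using R by (intro measure_pmf.finite_measure_mono) (auto intro!: power_mono)
    also have "\<dots> \<le> measure_pmf.expectation ?M (\<lambda>v. (sqrt n * ?\<delta> v)\<^sup>2) / R\<^sup>2"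
      using R integral_Markov_inequality_measure[of ?M "\<lambda>v. (sqrt n * ?\<delta> v)\<^sup>2" "{}" "R\<^sup>2"] int by simp
    also have "\<dots> \<le> C / R\<^sup>2" using E by (intro divide_right_mono) auto
    finally show "measure_pmf.prob ?M {v. R \<le> sqrt n * ?\<delta> v} \<le> C / R\<^sup>2" .
  qed
qed

lemma eventually_nhds_l1D:
  assumes "eventually P (nhds_l1 L p)"
  obtains r where "0 < r" "\<And>q. l1_dev L p q < r \<Longrightarrow> P q"
proof -
  obtain d where d: "d > 0" "\<And>q. dist (l1_dev L p q) 0 < d \<Longrightarrow> P q"
    using assms unfolding eventually_filtercomap eventually_nhds_metric by blast
  then show ?thesis using that[of d] l1_dev_nonneg[of L p] by simp
qed

text \<open>The bridge from deterministic statements about frequencies near \<open>p\<close> to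
  probabilities: a property valid on an \<open>r\<close>-ball can fail only at deviation at least
  \<open>r\<close>, which has probability at most \<open>C / (r\<^sup>2 * n)\<close>.\<close>

lemma multinomial_eventually_prob:
  assumes p: "\<And>j. j \<in> {1..L+1} \<Longrightarrow> 0 \<le> p j" "(\<Sum>j=1..L+1. p j) = 1"
    and P: "eventually P (nhds_l1 L p)"
  shows "(\<lambda>n. measure_pmf.prob (multinomial_pmf n (cat_pmf L p)) {v. \<not> P (\<lambda>j. real (v j) / real n)}) \<longlonglongrightarrow> 0"
proof -
  obtain C where C: "0 \<le> C"
    "\<And>n R. 0 < n \<Longrightarrow> 0 < R \<Longrightarrow> measure_pmf.prob (multinomial_pmf n (cat_pmf L p))
        {v. R \<le> sqrt (real n) * l1_dev L p (\<lambda>j. real (v j) / real n)} \<le> C / R\<^sup>2"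
    using multinomial_l1_dev_tail[OF p] by blast
  obtain r where r: "0 < r" "\<And>q. l1_dev L p q < r \<Longrightarrow> P q"
    using eventually_nhds_l1D[OF P] by blast
  have r': "r \<le> l1_dev L p q" if "\<not> P q" for q
    using r(2) that by force
  have "\<forall>\<^sub>F n in sequentially. norm (measure_pmf.prob (multinomial_pmf n (cat_pmf L p)) {v. \<not> P (\<lambda>j. real (v j) / real n)})
      \<le> C / r\<^sup>2 / real n"
    using eventually_gt_at_top[of 0]
  proof eventually_elim
    case (elim n)
    have "measure_pmf.prob (multinomial_pmf n (cat_pmf L p)) {v. \<not> P (\<lambda>j. real (v j) / real n)}
        \<le> measure_pmf.prob (multinomial_pmf n (cat_pmf L p))
          {v. sqrt n * r \<le> sqrt n * l1_dev L p (\<lambda>j. real (v j) / real n)}"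
      by (intro measure_pmf.finite_measure_mono) (auto intro!: mult_left_mono r')
    also have "\<dots> \<le> C / (sqrt n * r)\<^sup>2" using elim r by (intro C) auto
    also have "\<dots> = C / r\<^sup>2 / real n" by (simp add: power_mult_distrib)
    finally show ?case by simp
  qed
  then show ?thesis by (rule Lim_null_comparison) (rule lim_const_over_n)
qed

lemma tendsto_of_l1_expansion:
  fixes E :: "(nat \<Rightarrow> real) \<Rightarrow> 'a::real_normed_vector"
  assumes E: "\<And>e. 0 < e \<Longrightarrow> \<forall>\<^sub>F q in nhds_l1 L p.
      norm (E q - \<theta>0 - (\<Sum>j=1..L+1. (q j - p j) *\<^sub>R b j)) \<le> e * l1_dev L p q"
  shows "(E \<longlongrightarrow> \<theta>0) (nhds_l1 L p)"
proof -
  define K where "K = (\<Sum>j=1..L+1. norm (b j))"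
  note [simp del] = sum.cl_ivl_Suc
  have lin: "norm (\<Sum>j=1..L+1. (q j - p j) *\<^sub>R b j) \<le> K * l1_dev L p q" for q
    by (rule norm_sum_scaleR_l1_dev) (unfold K_def, rule member_le_sum, auto)
  have "\<forall>\<^sub>F q in nhds_l1 L p. norm (E q - \<theta>0) \<le> (K + 1) * l1_dev L p q"
    using E[OF zero_less_one]
  proof eventually_elim
    case (elim q)
    then show ?case
      using lin[of q] norm_triangle_sub[of "E q - \<theta>0" "\<Sum>j=1..L+1. (q j - p j) *\<^sub>R b j"]
      by (simp add: algebra_simps)
  qed
  moreover have "((\<lambda>q. (K + 1) * l1_dev L p q) \<longlongrightarrow> 0) (nhds_l1 L p)"
    by (rule tendsto_mult_right_zero[OF filterlim_filtercomap])
  ultimately have "((\<lambda>q. E q - \<theta>0) \<longlongrightarrow> 0) (nhds_l1 L p)"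
    by (rule Lim_null_comparison)
  then show ?thesis by (rule LIM_zero_cancel)
qed

lemma abs_cos_diff_le: "\<bar>cos x - cos y\<bar> \<le> \<bar>x - y\<bar>" for x y :: real
proof -
  have "\<bar>cos x - cos y\<bar> = 2 * \<bar>sin ((x + y) / 2)\<bar> * \<bar>sin ((y - x) / 2)\<bar>"
    by (simp add: cos_diff_cos abs_mult)
  also have "\<dots> \<le> 2 * 1 * \<bar>(y - x) / 2\<bar>"
    by (intro mult_mono abs_sin_x_le_abs_x) auto
  finally show ?thesis by (simp add: abs_minus_commute)
qed

theorem multinomial_delta_method:
  fixes E :: "(nat \<Rightarrow> real) \<Rightarrow> real^'n" and b :: "nat \<Rightarrow> real^'n"
  assumes p: "\<And>j. j \<in> {1..L+1} \<Longrightarrow> 0 \<le> p j" "(\<Sum>j=1..L+1. p j) = 1"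
    and E: "\<And>e. 0 < e \<Longrightarrow> \<forall>\<^sub>F q in nhds_l1 L p.
      norm (E q - \<theta>0 - (\<Sum>j=1..L+1. (q j - p j) *\<^sub>R b j)) \<le> e * l1_dev L p q"
  obtains \<mu> :: "(real^'n) measure" where "prob_space \<mu>" "sets \<mu> = sets borel"
    "\<And>t. distr \<mu> borel (\<lambda>z. t \<bullet> z) = normal0 (\<Sum>j=1..L+1. p j * (t \<bullet> b j - (\<Sum>i=1..L+1. p i * (t \<bullet> b i)))\<^sup>2)"
    "conv_law (\<lambda>n. measure_pmf (map_pmf (\<lambda>v. sqrt (real n) *\<^sub>R (E (\<lambda>j. real (v j) / real n) - \<theta>0))
       (multinomial_pmf n (cat_pmf L p)))) \<mu>"
proof -
  let ?A = "{1..L+1}" and ?D = "\<lambda>n. multinomial_pmf n (cat_pmf L p)"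
  note [simp del] = sum.cl_ivl_Suc
  define ph where "ph n v j = real (v j) / real n" for n and v :: "nat \<Rightarrow> nat" and j
  define \<delta> where "\<delta> n v = sqrt (real n) * l1_dev L p (ph n v)" for n v
  define X where "X n v = sqrt (real n) *\<^sub>R (E (ph n v) - \<theta>0)" for n v
  define Y where "Y n v = (\<Sum>j\<in>?A. (sqrt (real n) * (ph n v j - p j)) *\<^sub>R b j)" for n v
  define s where "s t = (\<Sum>j\<in>?A. p j * (t \<bullet> b j - (\<Sum>i\<in>?A. p i * (t \<bullet> b i)))\<^sup>2)" for t
  obtain C where C: "0 \<le> C"
    "\<And>n R. 0 < n \<Longrightarrow> 0 < R \<Longrightarrow> measure_pmf.prob (?D n) {v. R \<le> \<delta> n v} \<le> C / R\<^sup>2"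
    using multinomial_l1_dev_tail[OF p] unfolding \<delta>_def ph_def by blast
  have \<delta>0: "0 \<le> \<delta> n v" for n v unfolding \<delta>_def by (simp add: l1_dev_nonneg)
  have XY: "X n v - Y n v = sqrt (real n) *\<^sub>R (E (ph n v) - \<theta>0 - (\<Sum>j\<in>?A. (ph n v j - p j) *\<^sub>R b j))" for n v
    unfolding X_def Y_def by (simp add: scaleR_diff_right scaleR_sum_right)
  \<comment> \<open>The radius \<open>R\<close> is chosen before the property \<open>Q\<close>, so
    that the precision demanded by \<open>Q\<close> may depend on \<open>R\<close>.\<close>
  have tail: "\<exists>R>0. \<forall>Q. eventually Q (nhds_l1 L p) \<longrightarrow>
      (\<forall>\<^sub>F n in sequentially. measure_pmf.prob (?D n) {v. \<not> (Q (ph n v) \<and> \<delta> n v < R)} \<le> e)" if e: "0 < e" for e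
  proof (intro exI conjI allI impI)
    \<comment> \<open>Half of \<open>e\<close> goes to the Chebyshev bound
      \<open>C / R\<^sup>2\<close>, half to the failure of \<open>Q\<close>; \<open>C + 1\<close>
      keeps \<open>R\<close> positive when \<open>C = 0\<close>.\<close>
    define R where "R = sqrt (2 * (C + 1) / e)"
    show R: "0 < R" using e C(1) by (simp add: R_def)
    have R2: "C / R\<^sup>2 \<le> e / 2" using e C(1) by (simp add: R_def field_simps)
    fix Q assume Q: "eventually Q (nhds_l1 L p)"
    have "\<forall>\<^sub>F n in sequentially. measure_pmf.prob (?D n) {v. \<not> Q (ph n v)} < e / 2"
      using order_tendstoD(2)[OF multinomial_eventually_prob[OF p Q], of "e / 2"] e unfolding ph_def by simp
    then show "\<forall>\<^sub>F n in sequentially. measure_pmf.prob (?D n) {v. \<not> (Q (ph n v) \<and> \<delta> n v < R)} \<le> e"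
      using eventually_gt_at_top[of 0]
    proof eventually_elim
      case (elim n)
      have "{v. \<not> (Q (ph n v) \<and> \<delta> n v < R)} = {v. \<not> Q (ph n v)} \<union> {v. R \<le> \<delta> n v}" by auto
      then have "measure_pmf.prob (?D n) {v. \<not> (Q (ph n v) \<and> \<delta> n v < R)}
          \<le> measure_pmf.prob (?D n) {v. \<not> Q (ph n v)} + measure_pmf.prob (?D n) {v. R \<le> \<delta> n v}"
        using measure_Un_le[of "{v. \<not> Q (ph n v)}" "measure_pmf (?D n)" "{v. R \<le> \<delta> n v}"] by simp
      then show ?case using elim(1) C(2)[OF elim(2) R] R2 by linarith
    qed
  qed
  \<comment> \<open>A factorisation of the limiting covariance: the squares of
    \<open>t \<bullet> g j\<close> sum to the variance of \<open>t \<bullet> b j\<close> when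
    \<open>j\<close> is drawn with probabilities \<open>p\<close>.\<close>
  define g where "g j = sqrt (p j) *\<^sub>R (b j - (\<Sum>i\<in>?A. p i *\<^sub>R b i))" for j
  obtain \<mu> :: "(real^'n) measure" where \<mu>: "prob_space \<mu>" "sets \<mu> = sets borel"
    "\<And>t. distr \<mu> borel (\<lambda>z. t \<bullet> z) = normal0 (\<Sum>j\<in>?A. (t \<bullet> g j)\<^sup>2)"
    using gaussian_vector_exists[of ?A g] by blast
  have "(\<Sum>j\<in>?A. (t \<bullet> g j)\<^sup>2) = s t" for t
    unfolding s_def g_def using p(1)
    by (intro sum.cong) (auto simp: power_mult_distrib inner_diff_right inner_sum_right)
  with \<mu>(3) have \<mu>3: "\<And>t. distr \<mu> borel (\<lambda>z. t \<bullet> z) = normal0 (s t)" by simp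
  interpret \<mu>: prob_space \<mu> by (rule \<mu>)
  have s0: "0 \<le> s t" for t unfolding s_def using p(1) by (intro sum_nonneg) auto
  have bi: "integrable (measure_pmf D) f" if "\<And>x. norm (f x) \<le> B" for f :: "(nat \<Rightarrow> nat) \<Rightarrow> 'z::{banach,second_countable_topology}" and B D
    using that by (intro measure_pmf.integrable_const_bound[of _ B]) auto
  have cos_Re: "cos (x + c) = Re (iexp c * iexp x)" for x c :: real
    by (simp add: Re_exp Im_exp cos_add algebra_simps)
  have \<mu>_cos: "integral\<^sup>L \<mu> (\<lambda>z. cos (t \<bullet> z + c)) = Re (iexp c * exp (- (s t / 2)))" for t c
  proof -
    have m[measurable]: "(\<lambda>z. t \<bullet> z) \<in> borel_measurable \<mu>" using \<mu>(2) by (simp cong: measurable_cong_sets)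
    have i: "integrable \<mu> (\<lambda>z. iexp (t \<bullet> z))"
      by (rule \<mu>.integrable_iexp) auto
    have "integral\<^sup>L \<mu> (\<lambda>z. iexp (t \<bullet> z)) = char (distr \<mu> borel (\<lambda>z. t \<bullet> z)) 1"
      by (simp add: char_def integral_distr)
    also have "\<dots> = exp (- (s t / 2))"
      unfolding \<mu>3 char_normal0[OF s0] by simp
    finally have *: "integral\<^sup>L \<mu> (\<lambda>z. iexp (t \<bullet> z)) = exp (- (s t / 2))" .
    have "integral\<^sup>L \<mu> (\<lambda>z. cos (t \<bullet> z + c)) = integral\<^sup>L \<mu> (\<lambda>z. Re (iexp c * iexp (t \<bullet> z)))"
      by (simp only: cos_Re)
    also have "\<dots> = Re (integral\<^sup>L \<mu> (\<lambda>z. iexp c * iexp (t \<bullet> z)))"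
      by (rule integral_Re) (rule integrable_mult_right[OF i])
    finally show ?thesis by (simp only: * integral_mult_right_zero)
  qed
  have Y_cos: "(\<lambda>n. measure_pmf.expectation (?D n) (\<lambda>v. cos (t \<bullet> Y n v + c))) \<longlonglongrightarrow> Re (iexp c * exp (- (s t / 2)))" for t c
  proof -
    have tY: "t \<bullet> Y n v = (\<Sum>j=1..L+1. (t \<bullet> b j) * (sqrt (real n) * (real (v j) / real n - p j)))" for n v
      unfolding Y_def ph_def by (simp add: inner_sum_right mult.commute)
    have "(\<lambda>n. measure_pmf.expectation (?D n) (\<lambda>v. iexp (t \<bullet> Y n v))) \<longlonglongrightarrow> complex_of_real (exp (- (s t / 2)))"
      unfolding tY s_def using multinomial_iexp_tendsto[OF p, of "\<lambda>j. t \<bullet> b j"] .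
    then have "(\<lambda>n. Re (iexp c * measure_pmf.expectation (?D n) (\<lambda>v. iexp (t \<bullet> Y n v)))) \<longlonglongrightarrow> Re (iexp c * exp (- (s t / 2)))"
      by (intro tendsto_intros)
    moreover have "Re (iexp c * measure_pmf.expectation (?D n) (\<lambda>v. iexp (t \<bullet> Y n v)))
        = measure_pmf.expectation (?D n) (\<lambda>v. cos (t \<bullet> Y n v + c))" for n
    proof -
      have "measure_pmf.expectation (?D n) (\<lambda>v. cos (t \<bullet> Y n v + c))
          = measure_pmf.expectation (?D n) (\<lambda>v. Re (iexp c * iexp (t \<bullet> Y n v)))"
        by (simp only: cos_Re)
      also have "\<dots> = Re (measure_pmf.expectation (?D n) (\<lambda>v. iexp c * iexp (t \<bullet> Y n v)))"
        by (rule integral_Re) (rule bi[of _ 1], simp add: norm_mult)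
      finally show ?thesis by (simp only: integral_mult_right_zero)
    qed
    ultimately show ?thesis by simp
  qed
  have slutsky: "(\<lambda>n. measure_pmf.expectation (?D n) (\<lambda>v. cos (t \<bullet> X n v + c))
      - measure_pmf.expectation (?D n) (\<lambda>v. cos (t \<bullet> Y n v + c))) \<longlonglongrightarrow> 0" for t c
  proof (rule tendstoI)
    fix e :: real assume e: "0 < e"
    obtain R where R: "R > 0" "\<And>Q. eventually Q (nhds_l1 L p) \<Longrightarrow>
      \<forall>\<^sub>F n in sequentially. measure_pmf.prob (?D n) {v. \<not> (Q (ph n v) \<and> \<delta> n v < R)} \<le> e / 8"
      using tail[of "e / 8"] e by auto
    \<comment> \<open>Positive even for \<open>t = 0\<close>, so that
      \<open>e' * R * T = e / 2\<close> can be solved for \<open>e'\<close>. With probability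
      \<open>e / 8\<close> for the exceptional event and 2 bounding the difference of cosines, the
      total is \<open>3 * e / 4\<close>.\<close>
    define T where "T = norm t + 1"
    have T: "T > 0" by (simp add: T_def add_nonneg_pos)
    define e' where "e' = e / (2 * R * T)"
    have e': "e' > 0" using e R T by (simp add: e'_def)
    define Q where "Q q \<longleftrightarrow> norm (E q - \<theta>0 - (\<Sum>j=1..L+1. (q j - p j) *\<^sub>R b j)) \<le> e' * l1_dev L p q" for q
    have near: "\<bar>cos (t \<bullet> X n v + c) - cos (t \<bullet> Y n v + c)\<bar> \<le> e / 2" if "Q (ph n v)" "\<delta> n v < R" for n v
    proof -
      have "\<bar>cos (t \<bullet> X n v + c) - cos (t \<bullet> Y n v + c)\<bar> \<le> \<bar>t \<bullet> (X n v - Y n v)\<bar>"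
        using abs_cos_diff_le[of "t \<bullet> X n v + c" "t \<bullet> Y n v + c"] by (simp add: inner_diff_right)
      also have "\<dots> \<le> norm t * norm (X n v - Y n v)" by (rule Cauchy_Schwarz_ineq2)
      also have "norm (X n v - Y n v) \<le> sqrt n * (e' * l1_dev L p (ph n v))"
        unfolding XY using that(1) unfolding Q_def by (simp add: mult_left_mono)
      also have "\<dots> = e' * \<delta> n v" by (simp add: \<delta>_def)
      also have "\<dots> \<le> e' * R" using that(2) e' by simp
      also have "norm t * (e' * R) \<le> T * (e' * R)" using e' R by (intro mult_right_mono) (auto simp: T_def)
      also have "\<dots> = e / 2" using R(1) T by (simp add: e'_def)
      finally show ?thesis by (simp add: mult_left_mono)
    qed
    have "eventually Q (nhds_l1 L p)" unfolding Q_def by (rule E[OF e'])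
    from R(2)[OF this] show "\<forall>\<^sub>F n in sequentially. dist (measure_pmf.expectation (?D n) (\<lambda>v. cos (t \<bullet> X n v + c))
      - measure_pmf.expectation (?D n) (\<lambda>v. cos (t \<bullet> Y n v + c))) 0 < e"
    proof eventually_elim
      case (elim n)
      have two: "\<bar>cos x - cos y\<bar> \<le> 2" for x y :: real
        using abs_cos_le_one[of x] abs_cos_le_one[of y] by linarith
      have "\<bar>measure_pmf.expectation (?D n) (\<lambda>v. cos (t \<bullet> X n v + c))
          - measure_pmf.expectation (?D n) (\<lambda>v. cos (t \<bullet> Y n v + c))\<bar>
          \<le> e / 2 + 2 * measure_pmf.prob (?D n) {v. \<not> (Q (ph n v) \<and> \<delta> n v < R)}"
        using near two e by (intro measure_pmf.expectation_diff_le bi[of _ 1]) auto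
      then show ?case using elim e by simp
    qed
  qed
  define \<nu> where "\<nu> n = map_pmf (X n) (?D n)" for n
  have "conv_law (\<lambda>n. measure_pmf (\<nu> n)) \<mu>"
  proof (rule levy_continuity_pmf[OF \<mu>(1,2)])
    show "(\<lambda>n. measure_pmf.expectation (\<nu> n) (\<lambda>x. cos (t \<bullet> x + c))) \<longlonglongrightarrow> integral\<^sup>L \<mu> (\<lambda>x. cos (t \<bullet> x + c))" for t c
      unfolding \<mu>_cos \<nu>_def integral_map_pmf using Lim_transform[OF Y_cos slutsky] .
    fix e :: real assume e: "0 < e"
    obtain R where R: "R > 0" "\<And>Q. eventually Q (nhds_l1 L p) \<Longrightarrow>
      \<forall>\<^sub>F n in sequentially. measure_pmf.prob (?D n) {v. \<not> (Q (ph n v) \<and> \<delta> n v < R)} \<le> e"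
      using tail[OF e] by auto
    define K where "K = (\<Sum>j\<in>?A. norm (b j))"
    have K: "0 \<le> K" unfolding K_def by (intro sum_nonneg) auto
    define Q where "Q q \<longleftrightarrow> norm (E q - \<theta>0 - (\<Sum>j=1..L+1. (q j - p j) *\<^sub>R b j)) \<le> 1 * l1_dev L p q" for q
    have bound: "norm (X n v) \<le> (K + 1) * R" if "Q (ph n v)" "\<delta> n v < R" for n v
    proof -
      have lin: "norm (\<Sum>j\<in>?A. (ph n v j - p j) *\<^sub>R b j) \<le> K * l1_dev L p (ph n v)"
        by (rule norm_sum_scaleR_l1_dev) (unfold K_def, rule member_le_sum, auto)
      have "norm (E (ph n v) - \<theta>0) \<le> (K + 1) * l1_dev L p (ph n v)"
        using that(1) lin norm_triangle_sub[of "E (ph n v) - \<theta>0" "\<Sum>j\<in>?A. (ph n v j - p j) *\<^sub>R b j"]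
        unfolding Q_def by (simp add: algebra_simps)
      then have "norm (X n v) \<le> sqrt n * ((K + 1) * l1_dev L p (ph n v))"
        unfolding X_def by (simp add: mult_left_mono)
      also have "\<dots> = (K + 1) * \<delta> n v" by (simp add: \<delta>_def)
      also have "\<dots> \<le> (K + 1) * R" using that(2) K by (intro mult_left_mono) auto
      finally show ?thesis .
    qed
    have "eventually Q (nhds_l1 L p)" unfolding Q_def by (rule E) simp
    from R(2)[OF this] have "\<forall>\<^sub>F n in sequentially. measure_pmf.prob (\<nu> n) {x. norm x > (K + 1) * R} \<le> e"
    proof eventually_elim
      case (elim n)
      have "measure_pmf.prob (\<nu> n) {x. norm x > (K + 1) * R} = measure_pmf.prob (?D n) {v. norm (X n v) > (K + 1) * R}"
        unfolding \<nu>_def by (simp add: vimage_def)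
      also have "\<dots> \<le> measure_pmf.prob (?D n) {v. \<not> (Q (ph n v) \<and> \<delta> n v < R)}"
        using bound by (intro measure_pmf.finite_measure_mono) (auto dest: bound)
      finally show ?case using elim by linarith
    qed
    then show "\<exists>R. \<forall>\<^sub>F n in sequentially. measure_pmf.prob (\<nu> n) {x. norm x > R} \<le> e" by blast
  qed
  then show ?thesis
    using \<mu>(1,2) \<mu>3 unfolding \<nu>_def X_def ph_def s_def by (intro that[of \<mu>])
qed

section \<open>The step-stress model\<close>

text \<open>The gradient is hidden by the existential quantifier, so continuous differentiability of
  the cell probabilities follows from closure rules alone, without formulas for their partial
  derivatives.\<close>

definition C1_on :: "'a::real_inner set \<Rightarrow> ('a \<Rightarrow> real) \<Rightarrow> bool" where
  "C1_on S f \<longleftrightarrow> (\<exists>g. continuous_on S g \<and> (\<forall>x\<in>S. (f has_derivative (\<lambda>h. g x \<bullet> h)) (at x)))"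

lemma C1_onE:
  assumes "C1_on S f"
  obtains g where "continuous_on S g" "\<And>x. x \<in> S \<Longrightarrow> (f has_derivative (\<lambda>h. g x \<bullet> h)) (at x)"
  using assms unfolding C1_on_def by blast

lemma C1_onI:
  assumes "continuous_on S g" "\<And>x. x \<in> S \<Longrightarrow> (f has_derivative (\<lambda>h. g x \<bullet> h)) (at x)"
  shows "C1_on S f"
  using assms unfolding C1_on_def by blast

lemma C1_on_imp_continuous_on:
  assumes "C1_on S f" shows "continuous_on S f"
  using assms unfolding C1_on_def
  by (auto intro!: continuous_at_imp_continuous_on dest!: bspec has_derivative_continuous)

lemma C1_on_const: "C1_on S (\<lambda>_. c)"
  by (rule C1_onI[of _ "\<lambda>_. 0"]) auto

lemma C1_on_inner: "C1_on S (\<lambda>x. a \<bullet> x)"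
  by (rule C1_onI[of _ "\<lambda>_. a"]) (auto intro!: derivative_eq_intros)

lemma C1_on_add:
  assumes "C1_on S f" "C1_on S g" shows "C1_on S (\<lambda>x. f x + g x)"
proof -
  obtain f' g' where "continuous_on S f'" "\<And>x. x \<in> S \<Longrightarrow> (f has_derivative (\<lambda>h. f' x \<bullet> h)) (at x)"
     "continuous_on S g'" "\<And>x. x \<in> S \<Longrightarrow> (g has_derivative (\<lambda>h. g' x \<bullet> h)) (at x)"
    using assms C1_onE by metis
  then show ?thesis
    by (intro C1_onI[of _ "\<lambda>x. f' x + g' x"])
      (auto intro!: continuous_intros derivative_eq_intros simp: inner_add_left)
qed

lemma C1_on_mult:
  assumes "C1_on S f" "C1_on S g" shows "C1_on S (\<lambda>x. f x * g x)"
proof -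
  obtain f' g' where "continuous_on S f'" "\<And>x. x \<in> S \<Longrightarrow> (f has_derivative (\<lambda>h. f' x \<bullet> h)) (at x)"
     "continuous_on S g'" "\<And>x. x \<in> S \<Longrightarrow> (g has_derivative (\<lambda>h. g' x \<bullet> h)) (at x)"
    using assms C1_onE by metis
  then show ?thesis
    by (intro C1_onI[of _ "\<lambda>x. f x *\<^sub>R g' x + g x *\<^sub>R f' x"])
      (auto intro!: continuous_intros derivative_eq_intros C1_on_imp_continuous_on assms
        simp: inner_add_left mult.commute)
qed

lemma C1_on_sum:
  assumes "finite A" "\<And>i. i \<in> A \<Longrightarrow> C1_on S (f i)" shows "C1_on S (\<lambda>x. \<Sum>i\<in>A. f i x)"
  using assms by (induction A rule: finite_induct) (auto intro: C1_on_const C1_on_add)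

lemma C1_on_compose:
  assumes f: "C1_on S f" and S: "\<And>x. x \<in> S \<Longrightarrow> f x \<in> T"
    and \<phi>: "\<And>y. y \<in> T \<Longrightarrow> (\<phi> has_field_derivative \<phi>' y) (at y)" "continuous_on T \<phi>'"
  shows "C1_on S (\<lambda>x. \<phi> (f x))"
proof -
  obtain f' where f': "continuous_on S f'" "\<And>x. x \<in> S \<Longrightarrow> (f has_derivative (\<lambda>h. f' x \<bullet> h)) (at x)"
    using f C1_onE by metis
  show ?thesis
  proof (rule C1_onI[of _ "\<lambda>x. \<phi>' (f x) *\<^sub>R f' x"])
    show "continuous_on S (\<lambda>x. \<phi>' (f x) *\<^sub>R f' x)"
      using S by (intro continuous_intros f' continuous_on_compose2[OF \<phi>(2) C1_on_imp_continuous_on[OF f]]) auto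
    fix x assume x: "x \<in> S"
    have "((\<lambda>x. \<phi> (f x)) has_derivative (\<lambda>h. \<phi>' (f x) * (f' x \<bullet> h))) (at x)"
      using has_derivative_compose[OF f'(2)[OF x] \<phi>(1)[OF S[OF x], unfolded has_field_derivative_def]] .
    then show "((\<lambda>x. \<phi> (f x)) has_derivative (\<lambda>h. (\<phi>' (f x) *\<^sub>R f' x) \<bullet> h)) (at x)" by simp
  qed
qed

lemma C1_on_exp: "C1_on S f \<Longrightarrow> C1_on S (\<lambda>x. exp (f x))"
  by (rule C1_on_compose[of S f UNIV exp exp]) (auto intro!: continuous_intros DERIV_exp)

lemma C1_on_ln: "C1_on S f \<Longrightarrow> (\<And>x. x \<in> S \<Longrightarrow> f x > 0) \<Longrightarrow> C1_on S (\<lambda>x. ln (f x))"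
  by (rule C1_on_compose[of S f "{0<..}" ln inverse]) (auto intro!: continuous_intros DERIV_ln)

lemma C1_on_diff:
  assumes "C1_on S f" "C1_on S g" shows "C1_on S (\<lambda>x. f x - g x)"
  using C1_on_add[OF assms(1) C1_on_mult[OF C1_on_const[of S "-1"] assms(2)]] by simp

text \<open>The hidden gradient is recovered: differentiating along the coordinate axes forces its
  components to be the partial derivatives, the form in which \<open>wrow\<close> is
  defined.\<close>

lemma C1_on_partials:
  fixes f :: "real^'n \<Rightarrow> real"
  assumes "C1_on S f"
  shows "continuous_on S (\<lambda>x. \<chi> a. deriv (\<lambda>s. f (x + s *\<^sub>R axis a 1)) 0)"
    and "x \<in> S \<Longrightarrow> (f has_derivative (\<lambda>h. (\<chi> a. deriv (\<lambda>s. f (x + s *\<^sub>R axis a 1)) 0) \<bullet> h)) (at x)"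
proof -
  obtain g where g: "continuous_on S g" "\<And>x. x \<in> S \<Longrightarrow> (f has_derivative (\<lambda>h. g x \<bullet> h)) (at x)"
    using assms C1_onE by metis
  have eq: "(\<chi> a. deriv (\<lambda>s. f (x + s *\<^sub>R axis a 1)) 0) = g x" if "x \<in> S" for x
  proof -
    have "((\<lambda>s. f (x + s *\<^sub>R axis a 1)) has_derivative (\<lambda>s. g x \<bullet> (s *\<^sub>R axis a 1))) (at 0)" for a
      by (rule has_derivative_compose[of "\<lambda>s. x + s *\<^sub>R axis a 1"])
        (use g(2)[OF that] in \<open>auto intro!: derivative_eq_intros\<close>)
    moreover have "(\<lambda>s. g x \<bullet> (s *\<^sub>R axis a 1)) = (*) (g x $ a)" for a
      by (simp add: fun_eq_iff inner_axis)
    ultimately have "((\<lambda>s. f (x + s *\<^sub>R axis a 1)) has_field_derivative g x $ a) (at 0)" for a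
      by (simp only: has_field_derivative_def)
    then show ?thesis by (simp add: vec_eq_iff DERIV_imp_deriv)
  qed
  show "continuous_on S (\<lambda>x. \<chi> a. deriv (\<lambda>s. f (x + s *\<^sub>R axis a 1)) 0)"
    using g(1) eq by (simp cong: continuous_on_cong)
  show "(f has_derivative (\<lambda>h. (\<chi> a. deriv (\<lambda>s. f (x + s *\<^sub>R axis a 1)) 0) \<bullet> h)) (at x)" if "x \<in> S"
    using g(2)[OF that] eq[OF that] by simp
qed

section \<open>Parameter space, cumulative exposure and cell probabilities\<close>

lemma open_Theta: "open Theta"
proof -
  have "open ({\<theta> :: real^3. \<theta>$2 < 0} \<inter> {\<theta>. 0 < \<theta>$3})"
    by (intro open_Int open_Collect_less continuous_intros)
  also have "{\<theta> :: real^3. \<theta>$2 < 0} \<inter> {\<theta>. 0 < \<theta>$3} = Theta" by (auto simp: Theta_def)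
  finally show ?thesis .
qed

locale step_stress =
  fixes k L :: nat and x \<tau> t :: "nat \<Rightarrow> real"
  assumes k_pos: "1 \<le> k"
    and tau0: "\<tau> 0 = 0" and tau_mono: "\<And>i. i < k \<Longrightarrow> \<tau> i < \<tau> (Suc i)"
    and t0: "t 0 = 0" and t_mono: "\<And>j. j < L \<Longrightarrow> t j < t (Suc j)"
    and tL: "t L = \<tau> k"
begin

lemma tau_less: "i < j \<Longrightarrow> j \<le> k \<Longrightarrow> \<tau> i < \<tau> j"
proof (induction j)
  case (Suc j)
  then show ?case using tau_mono[of j] by (cases "i = j") auto
qed simp

lemma tau_le: "i \<le> j \<Longrightarrow> j \<le> k \<Longrightarrow> \<tau> i \<le> \<tau> j"
  using tau_less[of i j] by (cases "i = j") auto

lemma t_less: "i < j \<Longrightarrow> j \<le> L \<Longrightarrow> t i < t j"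
proof (induction j)
  case (Suc j)
  then show ?case using t_mono[of j] by (cases "i = j") auto
qed simp

lemma t_range: "j \<le> L \<Longrightarrow> t j \<in> {0..\<tau> k}"
  using t_less[of 0 j] t_less[of j L] t0 tL by (cases "j = 0"; cases "j = L") auto

lemma seg_bounds:
  assumes "s \<in> {0..\<tau> k}"
  shows "1 \<le> seg \<tau> k s" "seg \<tau> k s \<le> k" "\<tau> (seg \<tau> k s - 1) \<le> s" "s \<le> \<tau> (seg \<tau> k s)"
    "s < \<tau> k \<Longrightarrow> s < \<tau> (seg \<tau> k s)"
proof -
  have "1 \<le> seg \<tau> k s \<and> seg \<tau> k s \<le> k \<and> \<tau> (seg \<tau> k s - 1) \<le> s \<and> s \<le> \<tau> (seg \<tau> k s) \<and> (s < \<tau> k \<longrightarrow> s < \<tau> (seg \<tau> k s))"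
  proof (cases "\<tau> k \<le> s")
    case True
    then show ?thesis using assms k_pos tau_le[of "k - 1" k] by (auto simp: seg_def)
  next
    case False
    define i where "i = (LEAST i. s < \<tau> i)"
    have i: "s < \<tau> i" unfolding i_def by (rule LeastI[of _ k]) (use False in auto)
    have ik: "i \<le> k" unfolding i_def by (rule Least_le) (use False in auto)
    have i1: "1 \<le> i" using i tau0 assms by (cases i) auto
    have "\<not> s < \<tau> (i - 1)"
      using not_less_Least[of "i - 1" "\<lambda>i. s < \<tau> i"] i1 unfolding i_def[symmetric] by auto
    then show ?thesis using False i ik i1 by (simp add: seg_def i_def[symmetric])
  qed
  then show "1 \<le> seg \<tau> k s" "seg \<tau> k s \<le> k" "\<tau> (seg \<tau> k s - 1) \<le> s" "s \<le> \<tau> (seg \<tau> k s)"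
    "s < \<tau> k \<Longrightarrow> s < \<tau> (seg \<tau> k s)" by auto
qed

definition time_at :: "real \<Rightarrow> nat \<Rightarrow> real" where
  "time_at s l = max 0 (min s (\<tau> l) - \<tau> (l - 1))"

text \<open>With \<open>time_at s l\<close> the time spent at stress level \<open>l\<close> up to time \<open>s\<close>, the shifted and scaled time of the
  cumulative exposure model is the following sum, which no longer refers to the step containing \<open>s\<close>.\<close>

definition exposure :: "real^3 \<Rightarrow> real \<Rightarrow> real" where
  "exposure \<theta> s = (\<Sum>l=1..k. time_at s l / wscale x \<theta> l)"

lemma wscale_pos: "wscale x \<theta> i > 0"
  by (simp add: wscale_def)

text \<open>The shifts make the scaled age agree from both sides of each change of stress, so every
  completed step simply adds its duration divided by its own scale.\<close>

lemma shift_exposure: "(\<tau> n + shift x \<tau> \<theta> n) / wscale x \<theta> (Suc n) = (\<Sum>l=1..n. (\<tau> l - \<tau> (l - 1)) / wscale x \<theta> l)"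
proof (induction n)
  case 0
  then show ?case by (simp add: tau0)
next
  case (Suc n)
  have "(\<tau> (Suc n) + shift x \<tau> \<theta> (Suc n)) / wscale x \<theta> (Suc (Suc n)) = (\<tau> (Suc n) + shift x \<tau> \<theta> n) / wscale x \<theta> (Suc n)"
    using wscale_pos[of \<theta> "Suc (Suc n)"] by simp
  also have "\<dots> = (\<tau> n + shift x \<tau> \<theta> n) / wscale x \<theta> (Suc n) + (\<tau> (Suc n) - \<tau> n) / wscale x \<theta> (Suc n)"
    by (simp add: add_divide_distrib[symmetric])
  finally show ?case using Suc by simp
qed

lemma seg_exposure:
  assumes s: "s \<in> {0..\<tau> k}"
  shows "(s + shift x \<tau> \<theta> (seg \<tau> k s - 1)) / wscale x \<theta> (seg \<tau> k s) = exposure \<theta> s"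
proof -
  note seg = seg_bounds[OF s]
  define n where "n = seg \<tau> k s - 1"
  have n: "seg \<tau> k s = Suc n" "Suc n \<le> k" "\<tau> n \<le> s" "s \<le> \<tau> (Suc n)" using seg by (auto simp: n_def)
  have low: "time_at s l = \<tau> l - \<tau> (l - 1)" if "l \<in> {1..n}" for l
    using that n tau_le[of l n] tau_le[of "l - 1" l] by (auto simp: time_at_def)
  have high: "time_at s l = 0" if "l \<in> {Suc (Suc n)..k}" for l
  proof -
    have "\<tau> (Suc n) \<le> \<tau> (l - 1)" using that by (intro tau_le) auto
    then show ?thesis using n by (auto simp: time_at_def)
  qed
  have mid: "time_at s (Suc n) = s - \<tau> n" using n by (auto simp: time_at_def)
  \<comment> \<open>Levels below the current one have been used for their full duration, the current
    level in part, and later ones not at all.\<close>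
  have "{1..k} = {1..n} \<union> ({Suc n} \<union> {Suc (Suc n)..k})" using n by auto
  then have "exposure \<theta> s = (\<Sum>l\<in>{1..n} \<union> ({Suc n} \<union> {Suc (Suc n)..k}). time_at s l / wscale x \<theta> l)"
    unfolding exposure_def by simp
  also have "\<dots> = (\<Sum>l=1..n. time_at s l / wscale x \<theta> l) + (time_at s (Suc n) / wscale x \<theta> (Suc n)
      + (\<Sum>l=Suc (Suc n)..k. time_at s l / wscale x \<theta> l))"
    by (subst sum.union_disjoint; simp)+
  also have "\<dots> = (\<Sum>l=1..n. (\<tau> l - \<tau> (l - 1)) / wscale x \<theta> l) + (s - \<tau> n) / wscale x \<theta> (Suc n)"
    using low high mid by simp
  also have "\<dots> = (s + shift x \<tau> \<theta> n) / wscale x \<theta> (Suc n)"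
    unfolding shift_exposure[symmetric] by (simp add: add_divide_distrib[symmetric])
  finally show ?thesis using n by simp
qed

lemma cdfT_exposure:
  assumes "s \<in> {0..\<tau> k}"
  shows "cdfT x \<tau> k \<theta> s = 1 - exp (- (exposure \<theta> s powr \<theta>$3))"
  unfolding cdfT_def Let_def seg_exposure[OF assms] ..

lemma exposure_strict_mono:
  assumes "0 \<le> s" "s < s'" "s' \<le> \<tau> k"
  shows "exposure \<theta> s < exposure \<theta> s'"
  unfolding exposure_def
proof (rule sum_strict_mono_ex1)
  have s: "s \<in> {0..\<tau> k}" using assms by auto
  note seg = seg_bounds[OF s]
  show "\<forall>l\<in>{1..k}. time_at s l / wscale x \<theta> l \<le> time_at s' l / wscale x \<theta> l"
    using assms wscale_pos[of \<theta>] by (intro ballI divide_right_mono) (auto simp: time_at_def less_imp_le)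
  \<comment> \<open>Since \<open>s < \<tau> k\<close>, the level in force at \<open>s\<close> ends
    strictly after \<open>s\<close> and so gains time between \<open>s\<close> and
    \<open>s'\<close>.\<close>
  have "time_at s (seg \<tau> k s) < time_at s' (seg \<tau> k s)"
    using seg assms by (auto simp: time_at_def)
  then show "\<exists>l\<in>{1..k}. time_at s l / wscale x \<theta> l < time_at s' l / wscale x \<theta> l"
    using seg wscale_pos[of \<theta>] by (intro bexI[of _ "seg \<tau> k s"]) (auto simp: divide_strict_right_mono)
qed simp

lemma exposure_0: "exposure \<theta> 0 = 0"
proof -
  have "time_at 0 l = 0" if "l \<in> {1..k}" for l
  proof -
    have "0 \<le> \<tau> (l - 1)" using that tau_le[of 0 "l - 1"] tau0 by fastforce
    then show ?thesis by (auto simp: time_at_def)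
  qed
  then show ?thesis by (simp add: exposure_def)
qed

lemma exposure_pos: "0 < s \<Longrightarrow> s \<le> \<tau> k \<Longrightarrow> 0 < exposure \<theta> s"
  using exposure_strict_mono[of 0 s \<theta>] exposure_0 by simp

lemma cdfT_0: "cdfT x \<tau> k \<theta> 0 = 0"
proof -
  have "0 \<in> {0..\<tau> k}" using tau_le[of 0 k] tau0 by simp
  then show ?thesis by (simp add: cdfT_exposure exposure_0)
qed

lemma cdfT_strict_mono:
  assumes "\<theta> \<in> Theta" "0 \<le> s" "s < s'" "s' \<le> \<tau> k"
  shows "cdfT x \<tau> k \<theta> s < cdfT x \<tau> k \<theta> s'"
proof -
  have "0 \<le> exposure \<theta> s"
    using exposure_pos[of s \<theta>] exposure_0 assms by (cases "s = 0") auto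
  then have "exposure \<theta> s powr \<theta>$3 < exposure \<theta> s' powr \<theta>$3"
    using assms exposure_strict_mono by (intro powr_less_mono2) (auto simp: Theta_def)
  then show ?thesis using assms by (simp add: cdfT_exposure)
qed

lemma C1_on_cdfT:
  assumes s: "s \<in> {0..\<tau> k}"
  shows "C1_on Theta (\<lambda>\<theta>. cdfT x \<tau> k \<theta> s)"
\<comment> \<open>The power is differentiated as
  \<open>exp (\<theta>$3 * ln (exposure \<theta> s))\<close>, which requires positive exposure; at
  time 0 the exposure is 0 and the cdf is constantly 0.\<close>
proof (cases "s = 0")
  case True
  then show ?thesis by (simp add: cdfT_0 C1_on_const)
next
  case False
  then have e: "exposure \<theta> s > 0" for \<theta> using s exposure_pos by auto
  have coord: "C1_on Theta (\<lambda>\<theta>. \<theta> $ i)" for i :: 3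
    using C1_on_inner[of Theta "axis i 1"] by (simp add: inner_axis' )
  have "exposure \<theta> s = (\<Sum>l=1..k. time_at s l * exp (-1 * (\<theta>$1 + \<theta>$2 * x l)))" for \<theta>
    unfolding exposure_def wscale_def
    by (intro sum.cong refl) (simp add: divide_inverse flip: exp_minus)
  then have "C1_on Theta (\<lambda>\<theta>. exposure \<theta> s)"
    by (simp only:) (intro C1_on_sum C1_on_mult C1_on_const C1_on_exp C1_on_add coord finite_atLeastAtMost)
  then have "C1_on Theta (\<lambda>\<theta>. 1 - exp (-1 * exp (\<theta>$3 * ln (exposure \<theta> s))))"
    using e by (intro C1_on_diff C1_on_const C1_on_exp C1_on_mult C1_on_ln coord)
  then show ?thesis
    using e s by (simp add: cdfT_exposure powr_def less_imp_neq[symmetric])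
qed

lemma C1_on_piv:
  assumes "j \<in> {1..L+1}"
  shows "C1_on Theta (\<lambda>\<theta>. piv x \<tau> k t L \<theta> j)"
proof (cases "j \<le> L")
  case True
  then show ?thesis using assms
    by (simp add: piv_def) (intro C1_on_diff C1_on_cdfT t_range, auto)
next
  case False
  then show ?thesis using assms
    by (simp add: piv_def) (intro C1_on_diff C1_on_const C1_on_cdfT t_range, auto)
qed

lemma piv_pos:
  assumes "\<theta> \<in> Theta" "j \<in> {1..L+1}"
  shows "piv x \<tau> k t L \<theta> j > 0"
proof (cases "j \<le> L")
  case True
  then show ?thesis using assms t_range[of j] t_range[of "j - 1"] t_less[of "j - 1" j]
    by (auto simp: piv_def intro!: cdfT_strict_mono)
next
  case False
  then show ?thesis using t_range[of L] by (simp add: piv_def cdfT_exposure)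
qed

lemma sum_piv: "(\<Sum>j=1..L+1. piv x \<tau> k t L \<theta> j) = 1"
proof -
  let ?F = "\<lambda>j. cdfT x \<tau> k \<theta> (t j)"
  have "(\<Sum>j=1..n. ?F j - ?F (j - 1)) = ?F n - ?F 0" for n
    by (induction n) auto
  then have "(\<Sum>j=1..L. piv x \<tau> k t L \<theta> j) = ?F L - ?F 0"
    by (simp add: piv_def)
  then show ?thesis by (simp add: piv_def t0 cdfT_0)
qed

lemma
  assumes "j \<in> {1..L+1}"
  shows continuous_on_wrow: "continuous_on Theta (\<lambda>\<theta>. wrow x \<tau> k t L \<theta> j)"
    and has_derivative_piv: "\<theta> \<in> Theta \<Longrightarrow>
      ((\<lambda>\<theta>. piv x \<tau> k t L \<theta> j) has_derivative (\<lambda>h. wrow x \<tau> k t L \<theta> j \<bullet> h)) (at \<theta>)"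
  using C1_on_partials[OF C1_on_piv[OF assms]] unfolding wrow_def by auto

end

section \<open>Asymptotics of the restricted estimator\<close>

text \<open>\<open>Kmat\<close> with exponent \<open>\<beta>\<close> is \<open>Jmat\<close> with
  exponent \<open>2 * \<beta>\<close> minus the rank-one matrix of the vector
  \<open>z\<close>.\<close>

lemma Kmat_quadratic_form:
  "u \<bullet> (Kmat \<beta> L p w *v u) =
    (\<Sum>j=1..L+1. p j powr (2 * \<beta> - 1) * (w j \<bullet> u)\<^sup>2) - (\<Sum>j=1..L+1. p j powr \<beta> * (w j \<bullet> u))\<^sup>2"
proof -
  define z where "z = (\<Sum>j=1..L+1. p j powr \<beta> *\<^sub>R w j)"
  note [simp del] = sum.cl_ivl_Suc
  have z: "z \<bullet> u = (\<Sum>j=1..L+1. p j powr \<beta> * (w j \<bullet> u))"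
    by (simp add: z_def inner_sum_left)
  have "Kmat \<beta> L p w *v u = Jmat (2 * \<beta>) L p w *v u - (z \<bullet> u) *\<^sub>R z"
  proof (subst vec_eq_iff, intro allI)
    fix a
    have "Kmat \<beta> L p w $ a $ b = Jmat (2 * \<beta>) L p w $ a $ b - z $ a * z $ b" for b
      by (simp add: Kmat_def Jmat_def z_def mult.commute)
    then have "(Kmat \<beta> L p w *v u) $ a = (\<Sum>b\<in>UNIV. Jmat (2 * \<beta>) L p w $ a $ b * u $ b - z $ a * (z $ b * u $ b))"
      by (simp add: matrix_vector_mult_def left_diff_distrib mult.assoc)
    also have "\<dots> = (Jmat (2 * \<beta>) L p w *v u) $ a - z $ a * (z \<bullet> u)"
      by (simp only: sum_subtractf sum_distrib_left[symmetric]) (simp add: matrix_vector_mult_def inner_vec_def)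
    finally show "(Kmat \<beta> L p w *v u) $ a = (Jmat (2 * \<beta>) L p w *v u - (z \<bullet> u) *\<^sub>R z) $ a"
      by (simp add: mult.commute)
  qed
  then have "u \<bullet> (Kmat \<beta> L p w *v u) = u \<bullet> (Jmat (2 * \<beta>) L p w *v u) - (z \<bullet> u)\<^sup>2"
    by (simp add: inner_diff_right power2_eq_square inner_commute)
  also have "u \<bullet> (Jmat (2 * \<beta>) L p w *v u) = (\<Sum>j=1..L+1. p j powr (2 * \<beta> - 1) * (w j \<bullet> u)\<^sup>2)"
    unfolding Jmat_mult_vec by (simp add: inner_sum_right power2_eq_square inner_commute mult_ac)
  finally show ?thesis by (simp only: z)
qed

lemma sum_weighted_deviation:
  fixes p c :: "'i \<Rightarrow> real"
  assumes "(\<Sum>j\<in>A. p j) = 1"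
  shows "(\<Sum>j\<in>A. p j * (c j - (\<Sum>i\<in>A. p i * c i))\<^sup>2) = (\<Sum>j\<in>A. p j * (c j)\<^sup>2) - (\<Sum>j\<in>A. p j * c j)\<^sup>2"
proof -
  define m where "m = (\<Sum>i\<in>A. p i * c i)"
  have "(\<Sum>j\<in>A. p j * (c j - m)\<^sup>2) = (\<Sum>j\<in>A. p j * (c j)\<^sup>2 - 2 * m * (p j * c j) + m\<^sup>2 * p j)"
    by (intro sum.cong) (auto simp: power2_eq_square algebra_simps)
  also have "\<dots> = (\<Sum>j\<in>A. p j * (c j)\<^sup>2) - 2 * m * m + m\<^sup>2 * 1"
    by (simp only: sum.distrib sum_subtractf sum_distrib_left[symmetric] m_def[symmetric] assms)
  finally show ?thesis by (simp add: m_def power2_eq_square)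
qed

text \<open>Moving \<open>P\<close> to the other side of the inner product leaves the variance of
  \<open>p j powr (\<beta> - 1) * (w j \<bullet> u)\<close> with
  \<open>u = transpose P *v t\<close>. Weighting by \<open>p j\<close> raises the exponent to
  \<open>\<beta>\<close> in the mean and to \<open>2 * \<beta> - 1\<close> in the second moment,
  which are the exponents in \<open>Kmat\<close>.\<close>

lemma sandwich_variance:
  fixes P :: "real^3^3" and p :: "nat \<Rightarrow> real" and w :: "nat \<Rightarrow> real^3" and \<beta> :: real
  assumes p: "\<And>j. j \<in> {1..L+1} \<Longrightarrow> 0 < p j" "(\<Sum>j=1..L+1. p j) = 1"
  defines "b \<equiv> \<lambda>j. P *v (p j powr (\<beta> - 1) *\<^sub>R w j)"
  shows "(\<Sum>j=1..L+1. p j * (t \<bullet> b j - (\<Sum>i=1..L+1. p i * (t \<bullet> b i)))\<^sup>2)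
    = t \<bullet> ((P ** Kmat \<beta> L p w ** transpose P) *v t)"
proof -
  define u where "u = transpose P *v t"
  note [simp del] = sum.cl_ivl_Suc
  have adj: "t \<bullet> (P *v y) = u \<bullet> y" for y
    by (simp add: u_def dot_lmul_matrix)
  have tb: "t \<bullet> b j = p j powr (\<beta> - 1) * (w j \<bullet> u)" for j
    by (simp add: b_def adj inner_commute)
  have pb: "p j * (t \<bullet> b j) = p j powr \<beta> * (w j \<bullet> u)" if "j \<in> {1..L+1}" for j
    using p(1)[OF that] by (simp add: tb powr_diff)
  have pb2: "p j * (t \<bullet> b j)\<^sup>2 = p j powr (2 * \<beta> - 1) * (w j \<bullet> u)\<^sup>2" if "j \<in> {1..L+1}" for j
  proof -
    have "p j * (t \<bullet> b j)\<^sup>2 = (p j powr \<beta> * (w j \<bullet> u)) * (p j powr (\<beta> - 1) * (w j \<bullet> u))"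
      using pb[OF that] by (simp add: power2_eq_square tb[symmetric] mult.assoc[symmetric])
    also have "\<dots> = p j powr (\<beta> + (\<beta> - 1)) * (w j \<bullet> u)\<^sup>2"
      by (simp only: powr_add power2_eq_square mult_ac)
    also have "\<beta> + (\<beta> - 1) = 2 * \<beta> - 1" by simp
    finally show ?thesis .
  qed
  have "t \<bullet> ((P ** Kmat \<beta> L p w ** transpose P) *v t) = u \<bullet> (Kmat \<beta> L p w *v u)"
    unfolding u_def[symmetric] adj[symmetric]
    by (simp only: u_def matrix_vector_mul_assoc matrix_mul_assoc)
  then show ?thesis
    unfolding Kmat_quadratic_form sum_weighted_deviation[OF p(2)]
    by (simp only: pb pb2 cong: sum.cong)
qed

theorem theorem2:
  fixes k L :: nat
    and x \<tau> t :: "nat \<Rightarrow> real"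
    and \<beta> :: real
    and m :: "real^3 \<Rightarrow> real^'r"
    and M :: "real^3 \<Rightarrow> real^'r^3"
    and \<theta>0 :: "real^3"
  defines "p \<equiv> piv x \<tau> k t L"
    and "w \<equiv> wrow x \<tau> k t L"
  defines "J \<equiv> Jmat \<beta> L (p \<theta>0) (w \<theta>0)"
    and "K \<equiv> Kmat \<beta> L (p \<theta>0) (w \<theta>0)"
  defines "Q \<equiv> matrix_inv J ** M \<theta>0 ** matrix_inv (transpose (M \<theta>0) ** matrix_inv J ** M \<theta>0)"
  defines "P \<equiv> matrix_inv J - Q ** transpose (M \<theta>0) ** matrix_inv J"
  defines "\<Sigma> \<equiv> P ** K ** transpose P"
  assumes k_pos: "1 \<le> k" and L_pos: "1 \<le> L"
    and x_mono: "\<And>i. 1 \<le> i \<Longrightarrow> i < k \<Longrightarrow> x i < x (Suc i)"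
    and tau0: "\<tau> 0 = 0" and tau_mono: "\<And>i. i < k \<Longrightarrow> \<tau> i < \<tau> (Suc i)"
    and t0: "t 0 = 0" and t_mono: "\<And>j. j < L \<Longrightarrow> t j < t (Suc j)"
    and tL: "t L = \<tau> k"
    and tau_in_t: "\<And>i. 1 \<le> i \<Longrightarrow> i \<le> k \<Longrightarrow> \<exists>j\<le>L. t j = \<tau> i"
    and r_le: "CARD('r) \<le> 3"
    and m_deriv: "\<And>\<theta>. \<theta> \<in> Theta \<Longrightarrow> (m has_derivative (\<lambda>h. transpose (M \<theta>) *v h)) (at \<theta>)"
    and M_cont: "continuous_on Theta M"
    and M_rank: "\<And>\<theta>. \<theta> \<in> Theta \<Longrightarrow> rank (M \<theta>) = CARD('r)"
    and beta_nonneg: "0 \<le> \<beta>"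
    and theta0_in: "\<theta>0 \<in> Theta" and theta0_restr: "m \<theta>0 = 0"
    and J_inv: "invertible J"
    and MJM_inv: "invertible (transpose (M \<theta>0) ** matrix_inv J ** M \<theta>0)"
  shows "\<exists>est :: nat \<Rightarrow> (nat \<Rightarrow> real) \<Rightarrow> real^3.
     let data = (\<lambda>N. multinomial_pmf N (cat_pmf L (p \<theta>0)));
         phat = (\<lambda>N (v :: nat \<Rightarrow> nat) j. real (v j) / real N)
     in
     \<comment> \<open>(1a) est N is, with probability tending to 1, a root of the RMDPDE equations\<close>
     (\<lambda>N. measure_pmf.prob (data N)
            {v. est N (phat N v) \<in> Theta \<and>
                (\<exists>lam. rmdpde_eqs \<beta> L p w m M (phat N v) (est N (phat N v)) lam)})
       \<longlonglongrightarrow> 1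
     \<comment> \<open>(1b) consistency: convergence in probability to theta0\<close>
     \<and> (\<forall>\<epsilon>>0. (\<lambda>N. measure_pmf.prob (data N) {v. dist (est N (phat N v)) \<theta>0 > \<epsilon>})
                 \<longlonglongrightarrow> 0)
     \<comment> \<open>(2) asymptotic normality\<close>
     \<and> (\<exists>\<mu>. is_normal_vec \<mu> \<Sigma> \<and>
          conv_law (\<lambda>N. measure_pmf (map_pmf (\<lambda>v. sqrt (real N) *\<^sub>R (est N (phat N v) - \<theta>0))
                                          (data N))) \<mu>)"
proof -
  interpret step_stress k L x \<tau> t
    by unfold_locales (use k_pos tau0 tau_mono t0 t_mono tL in auto)
  let ?A = "{1..L+1}" and ?G = "nhds_l1 L (p \<theta>0)"
  have p_pos: "0 < p \<theta> j" if "j \<in> ?A" "\<theta> \<in> Theta" for j \<theta>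
    unfolding p_def using piv_pos[OF that(2,1)] .
  have p_nonneg: "0 \<le> p \<theta>0 j" if "j \<in> ?A" for j
    using p_pos[OF that theta0_in] by simp
  have p_sum: "(\<Sum>j=1..L+1. p \<theta>0 j) = 1"
    unfolding p_def by (rule sum_piv)
  have p_deriv: "((\<lambda>\<theta>. p \<theta> j) has_derivative (\<lambda>h. w \<theta> j \<bullet> h)) (at \<theta>)" if "j \<in> ?A" "\<theta> \<in> Theta" for j \<theta>
    unfolding p_def w_def by (rule has_derivative_piv[OF that])
  have w_cont: "continuous_on Theta (\<lambda>\<theta>. w \<theta> j)" if "j \<in> ?A" for j
    unfolding w_def by (rule continuous_on_wrow[OF that])
  define b where "b j = P *v (p \<theta>0 j powr (\<beta> - 1) *\<^sub>R w \<theta>0 j)" for j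
  have "\<exists>E. (\<forall>\<^sub>F q in ?G. \<exists>lam. rmdpde_eqs \<beta> L p w m M q (E q) lam) \<and>
      (\<forall>e>0. \<forall>\<^sub>F q in ?G. norm (E q - \<theta>0 - (\<Sum>j=1..L+1. (q j - p \<theta>0 j) *\<^sub>R b j)) \<le> e * l1_dev L (p \<theta>0) q)"
    unfolding b_def P_def Q_def J_def
    by (rule rmdpde_root_expansion[OF open_Theta theta0_in p_pos p_deriv w_cont m_deriv M_cont theta0_restr
          J_inv[unfolded J_def] MJM_inv[unfolded J_def]]) blast+
  then obtain E where root: "\<forall>\<^sub>F q in ?G. \<exists>lam. rmdpde_eqs \<beta> L p w m M q (E q) lam"
    and expansion: "\<And>e. 0 < e \<Longrightarrow>
      \<forall>\<^sub>F q in ?G. norm (E q - \<theta>0 - (\<Sum>j=1..L+1. (q j - p \<theta>0 j) *\<^sub>R b j)) \<le> e * l1_dev L (p \<theta>0) q"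
    by blast
  have E_lim: "(E \<longlongrightarrow> \<theta>0) ?G"
    by (rule tendsto_of_l1_expansion[OF expansion])
  have cons: "(\<lambda>n. measure_pmf.prob (multinomial_pmf n (cat_pmf L (p \<theta>0))) {v. dist (E (\<lambda>j. real (v j) / real n)) \<theta>0 > e}) \<longlonglongrightarrow> 0"
    if "e > 0" for e
  proof -
    have "\<forall>\<^sub>F q in ?G. \<not> dist (E q) \<theta>0 > e"
      using tendstoD[OF E_lim that] by eventually_elim simp
    from multinomial_eventually_prob[OF p_nonneg p_sum this] show ?thesis by simp
  qed
  have roots: "(\<lambda>n. measure_pmf.prob (multinomial_pmf n (cat_pmf L (p \<theta>0)))
      {v. E (\<lambda>j. real (v j) / real n) \<in> Theta \<and>
        (\<exists>lam. rmdpde_eqs \<beta> L p w m M (\<lambda>j. real (v j) / real n) (E (\<lambda>j. real (v j) / real n)) lam)}) \<longlonglongrightarrow> 1"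
  proof -
    define R where "R q \<longleftrightarrow> E q \<in> Theta \<and> (\<exists>lam. rmdpde_eqs \<beta> L p w m M q (E q) lam)" for q
    \<comment> \<open>Membership in \<open>Theta\<close> holds near the true frequencies because
      \<open>E\<close> tends to \<open>\<theta>0\<close> and \<open>Theta\<close> is open.\<close>
    have "eventually R ?G"
      using root topological_tendstoD[OF E_lim open_Theta theta0_in] unfolding R_def by eventually_elim blast
    from multinomial_eventually_prob[OF p_nonneg p_sum this]
    have "(\<lambda>n. 1 - measure_pmf.prob (multinomial_pmf n (cat_pmf L (p \<theta>0))) {v. \<not> R (\<lambda>j. real (v j) / real n)}) \<longlonglongrightarrow> 1 - 0"
      by (intro tendsto_intros)
    moreover have "1 - measure_pmf.prob D {v. \<not> S v} = measure_pmf.prob D {v. S v}" for D :: "(nat \<Rightarrow> nat) pmf" and S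
      using measure_pmf.prob_compl[of "{v. \<not> S v}" D] by (simp add: set_diff_eq)
    ultimately show ?thesis unfolding R_def[symmetric] by (simp only: diff_zero)
  qed
  obtain \<mu> :: "(real^3) measure" where \<mu>: "prob_space \<mu>" "sets \<mu> = sets borel"
    "\<And>t. distr \<mu> borel (\<lambda>z. t \<bullet> z) = normal0 (\<Sum>j=1..L+1. p \<theta>0 j * (t \<bullet> b j - (\<Sum>i=1..L+1. p \<theta>0 i * (t \<bullet> b i)))\<^sup>2)"
    "conv_law (\<lambda>n. measure_pmf (map_pmf (\<lambda>v. sqrt (real n) *\<^sub>R (E (\<lambda>j. real (v j) / real n) - \<theta>0))
       (multinomial_pmf n (cat_pmf L (p \<theta>0))))) \<mu>"
    using multinomial_delta_method[OF p_nonneg p_sum expansion] by blast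
  have "(\<Sum>j=1..L+1. p \<theta>0 j * (u \<bullet> b j - (\<Sum>i=1..L+1. p \<theta>0 i * (u \<bullet> b i)))\<^sup>2) = u \<bullet> (\<Sigma> *v u)" for u
    unfolding b_def \<Sigma>_def K_def using p_pos[OF _ theta0_in] p_sum by (rule sandwich_variance)
  with \<mu>(1-3) have "is_normal_vec \<mu> \<Sigma>"
    unfolding is_normal_vec_def by simp
  \<comment> \<open>A single deterministic function \<open>E\<close> of the frequencies serves as
    estimator for every sample size.\<close>
  with \<mu>(4) roots cons show ?thesis
    unfolding Let_def by (intro exI[of _ "\<lambda>_. E"] conjI allI impI exI[of _ \<mu>])
qed

end
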